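(* For all integers $d\ge2$ and $N\ge2$, the critical point $\hat p_c=\hat p_c(N,d)$ satisfies $0<\hat p_c<1$. Moreover $\phi_A(\hat p_c)>0$, while $\mathcal C_N$ is almost surely totally disconnected when $p<\hat p_c$. Hence $\hat p_c(N,d)=\tilde p_c(N,d)$ for every $N$ and $d$.
   Context: Mandelbrot's fractal percolation: for integers $d\ge2$, $N\ge2$ and $0<p<1$, partition the unit cube $[0,1]^d$ into $N^d$ (closed) subcubes of equal size (side length $1/N$). Each subcube is independently retained with probability $p$ and discarded otherwise; the union of retained subcubes is the random set $\mathcal C_N^1\subset[0,1]^d$. The same procedure is repeated independently inside each retained subcube (split into $N^d$ equal subcubes, each retained with probability $p$), giving $\mathcal C_N^2\subset\mathcal C_N^1$, and so on, yielding $[0,1]^d\supset\mathcal C_N^1\supset\mathcal C_N^2\supset\cdots$. The limiting retained set is $\mathcal C_N=\mathcal C_N(d,p)=\bigcap_{k\ge1}\mathcal C_N^k$. A set is totally disconnected if it contains no connected component larger than one point. Define $$\tilde p_c(N,d)=\sup\{p:\ \mathcal C_N\text{ is totally disconnected with probability one}\}.$$ Let $A=(0,1)^d\setminus[1/3,2/3]^d$ be the open unit cube with the concentric closed cube of side length $1/3$ removed; its inner boundary is $\partial([1/3,2/3]^d)$ and its outer boundary is $\partial([0,1]^d)$. Let $\phi_A(p)$ be the probability that the limiting retained set $\mathcal C_N$ (with retention probability $p$) contains a connected component that intersects both the inner and the outer boundary of $A$. Define $\hat p_c(N,d)=\inf\{p:\phi_A(p)>0\}$. *)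

theory Defs
  imports "HOL-Probability.Probability"
begin

text \<open>
  The dimension \<open>d\<close> is \<open>CARD('n)\<close>.  A level-\<open>k\<close> subcube of the unit cube is addressed by
  \<open>j :: nat ^ 'n\<close> with all coordinates below \<open>N ^ k\<close>; its parent at level \<open>k - 1\<close> has the address
  obtained by dividing every coordinate of \<open>j\<close> by \<open>N\<close>.
\<close>

definition subcube :: "nat \<Rightarrow> nat \<Rightarrow> nat ^ 'n \<Rightarrow> (real ^ 'n) set" where
  "subcube N k j = cbox (\<chi> i. real (j $ i) / real (N ^ k)) (\<chi> i. (real (j $ i) + 1) / real (N ^ k))"

text \<open>
  One independent Bernoulli(\<open>p\<close>) coin for every level and every address.  Coins at level \<open>0\<close>, at
  out-of-range addresses and in cubes with a discarded ancestor are never consulted, so this is the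
  usual independent subdivision procedure.
\<close>

definition coins :: "real \<Rightarrow> (nat \<times> (nat ^ 'n) \<Rightarrow> bool) measure" where
  "coins p = PiM UNIV (\<lambda>_. measure_pmf (bernoulli_pmf p))"

primrec retained_cubes :: "nat \<Rightarrow> (nat \<times> (nat ^ 'n) \<Rightarrow> bool) \<Rightarrow> nat \<Rightarrow> (nat ^ 'n) set" where
  "retained_cubes N \<omega> 0 = {\<chi> i. 0}"
| "retained_cubes N \<omega> (Suc k) =
     {j. (\<chi> i. j $ i div N) \<in> retained_cubes N \<omega> k \<and> \<omega> (Suc k, j)}"

definition retained_set :: "nat \<Rightarrow> (nat \<times> (nat ^ 'n) \<Rightarrow> bool) \<Rightarrow> nat \<Rightarrow> (real ^ 'n) set" where
  "retained_set N \<omega> k = (\<Union>j\<in>retained_cubes N \<omega> k. subcube N k j)"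

definition limit_set :: "nat \<Rightarrow> (nat \<times> (nat ^ 'n) \<Rightarrow> bool) \<Rightarrow> (real ^ 'n) set" where
  "limit_set N \<omega> = (\<Inter>k\<in>{1..}. retained_set N \<omega> k)"

definition totally_disconnected :: "'a::topological_space set \<Rightarrow> bool" where
  "totally_disconnected S \<longleftrightarrow> (\<forall>C\<in>components S. \<exists>x. C = {x})"

definition inner_boundary :: "(real ^ 'n) set" where
  "inner_boundary = frontier (cbox (\<chi> i. 1 / 3) (\<chi> i. 2 / 3))"

definition outer_boundary :: "(real ^ 'n) set" where
  "outer_boundary = frontier (cbox (\<chi> i. 0) (\<chi> i. 1))"

definition crosses_annulus :: "(real ^ 'n) set \<Rightarrow> bool" where
  "crosses_annulus S \<longleftrightarrow>
     (\<exists>C\<in>components S. C \<inter> inner_boundary \<noteq> {} \<and> C \<inter> outer_boundary \<noteq> {})"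

definition crossing_prob :: "'n::finite itself \<Rightarrow> nat \<Rightarrow> real \<Rightarrow> real" where
  "crossing_prob _ N p =
     measure (coins p)
       {\<omega> \<in> space (coins p). crosses_annulus (limit_set N \<omega> :: (real ^ 'n) set)}"

definition pc_hat :: "'n::finite itself \<Rightarrow> nat \<Rightarrow> real" where
  "pc_hat d N = Inf {p. 0 < p \<and> p < 1 \<and> crossing_prob d N p > 0}"

definition pc_tilde :: "'n::finite itself \<Rightarrow> nat \<Rightarrow> real" where
  "pc_tilde _ N =
     Sup {p. 0 < p \<and> p < 1 \<and>
             (AE \<omega> in coins p. totally_disconnected (limit_set N \<omega> :: (real ^ 'n) set))}"

end

theory Submission
  imports Defs
begin

text \<open>
  Everything rests on one finite-volume quantity.  Retain all cubes of level at most 3, fix a level-3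
  cube inside the middle third of the unit cube, and let \<open>u p k\<close> be the probability that after \<open>k\<close>
  further levels a chain of touching surviving cubes joins it to the boundary of the unit cube.  Such a
  chain contains two crossings of the same kind, three levels finer and in disjoint blocks, so
  \<open>u p (k + 3) \<le> C * (u p k)\<^sup>2\<close> with \<open>C\<close> independent of \<open>p\<close>.  If \<open>C * u p k < 1\<close> for a single \<open>k\<close> then
  \<open>u p\<close> tends to 0, and since a connected subset of the limit set with two points produces crossings
  of arbitrary depth around some cube, the limit set is almost surely totally disconnected.  If on
  the other hand \<open>u p k \<ge> 1 / C\<close> for every \<open>k\<close>, compactness gives a component of the limit set
  crossing the annulus with positive probability.  So the crossing probability is positive exactly
  when \<open>u p k \<ge> 1 / C\<close> for all \<open>k\<close>, and each \<open>u p k\<close> is a polynomial in \<open>p\<close>, increasing, and zero at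
  \<open>p = 0\<close> when \<open>k = 1\<close>: this makes the supercritical set closed, and the critical point positive.

  For \<open>p\<close> close to 1, a two-dimensional slice already has a nontrivial component: call a square good
  if all its children survive and all but at most one of its \<open>N ^ 4\<close> grandchildren survive and are good
  in turn.  The probability of not being good is at most quadratic in itself up to an error
  \<open>N\<^sup>2 * (1 - p)\<close>, hence stays small at all depths.
\<close>

section \<open>Events determined by finitely many coins\<close>

text \<open>The scale of three levels comes from \<open>N = 2\<close>: some level-3 cube always lies
  in the middle third and keeps one full level-3 cube between itself and every face, whereas no
  level-2 cube of the binary grid fits in the middle third. Seen three levels finer, a window of
  \<open>N ^ 3\<close> cubes per side is as wide as one level-3 cube, so windows around the two ends
  of a crossing are disjoint and their events independent. The constant \<open>C\<close> is the
  squared number of level-6 addresses, from a union bound over both positions.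

  Infinite-volume events are never handled directly. Independence, translation, and monotonicity and
  continuity in \<open>p\<close> are statements about finite sums over coin configurations. Since
  \<open>1 / C\<close> bounds every \<open>u p k\<close> at once, closedness of a polynomial
  inequality stands in for any continuity of the crossing probability.

  Near \<open>p = 1\<close> the construction moves two levels at a time. If \<open>N = 2\<close>,
  adjacent squares that each lack one child may have no common intact row, whereas a grid of side
  \<open>N ^ 2\<close>, at least 4, always leaves one.\<close>

definition determined_by :: "'i set \<Rightarrow> (('i \<Rightarrow> bool) \<Rightarrow> bool) \<Rightarrow> bool" where
  "determined_by F E \<longleftrightarrow> (\<forall>\<omega> \<omega>'. (\<forall>i\<in>F. \<omega> i = \<omega>' i) \<longrightarrow> E \<omega> = E \<omega>')"

definition increasing_event :: "(('i \<Rightarrow> bool) \<Rightarrow> bool) \<Rightarrow> bool" where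
  "increasing_event E \<longleftrightarrow> (\<forall>\<omega> \<omega>'. (\<forall>i. \<omega> i \<longrightarrow> \<omega>' i) \<longrightarrow> E \<omega> \<longrightarrow> E \<omega>')"

text \<open>\<open>S\<close> is the set of coins in \<open>F\<close> that show True, and coins
  outside \<open>F\<close> are set to False. For fixed \<open>F\<close> and \<open>E\<close> this is
  a polynomial in \<open>p\<close>, meaningful for every real \<open>p\<close>.\<close>

definition bernoulli_sum :: "real \<Rightarrow> 'i set \<Rightarrow> (('i \<Rightarrow> bool) \<Rightarrow> bool) \<Rightarrow> real" where
  "bernoulli_sum p F E =
     (\<Sum>S\<in>Pow F. of_bool (E (\<lambda>i. i \<in> S)) * (p ^ card S * (1 - p) ^ card (F - S)))"

lemma determined_byD:
  "determined_by F E \<Longrightarrow> (\<And>i. i \<in> F \<Longrightarrow> \<omega> i = \<omega>' i) \<Longrightarrow> E \<omega> = E \<omega>'"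
  unfolding determined_by_def by blast

lemma determined_by_conj:
  assumes "determined_by F E" "determined_by G E'"
  shows "determined_by (F \<union> G) (\<lambda>\<omega>. E \<omega> \<and> E' \<omega>)"
  unfolding determined_by_def
proof (intro allI impI)
  fix \<omega> \<omega>' :: "'a \<Rightarrow> bool" assume "\<forall>i\<in>F \<union> G. \<omega> i = \<omega>' i"
  then show "(E \<omega> \<and> E' \<omega>) = (E \<omega>' \<and> E' \<omega>')"
    using determined_byD[OF assms(1)] determined_byD[OF assms(2)] by (metis UnCI)
qed

lemma determined_by_coin: "determined_by {z} (\<lambda>\<omega>. \<omega> z)"
  by (simp add: determined_by_def)

lemma determined_by_not: "determined_by F E \<Longrightarrow> determined_by F (\<lambda>\<omega>. \<not> E \<omega>)"
  unfolding determined_by_def by blast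

section \<open>The coin measure on events that depend on finitely many coins\<close>

lemma space_coins [simp]: "space (coins p) = UNIV"
  by (simp add: coins_def space_PiM)

lemma prob_space_coins: "prob_space (coins p)"
  unfolding coins_def by (intro prob_space_PiM measure_pmf.prob_space_axioms)

interpretation coins: prob_space "coins p" for p
  by (rule prob_space_coins)

lemma cylinder_coins:
  fixes F S :: "(nat \<times> (nat ^ 'n::finite)) set"
  assumes "0 \<le> p" "p \<le> 1" "finite F" "S \<subseteq> F"
  shows "{\<omega>. \<forall>i\<in>F. \<omega> i = (i \<in> S)} \<in> sets (coins p)"
    and "measure (coins p) {\<omega>. \<forall>i\<in>F. \<omega> i = (i \<in> S)} = p ^ card S * (1 - p) ^ card (F - S)"
proof -
  let ?M = "\<lambda>_::nat \<times> (nat ^ 'n). measure_pmf (bernoulli_pmf p)"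
  interpret product_prob_space ?M UNIV
    by unfold_locales
  have eq: "{\<omega>. \<forall>i\<in>F. \<omega> i = (i \<in> S)} = prod_emb UNIV ?M F (\<Pi>\<^sub>E i\<in>F. {i \<in> S})"
    by (auto simp: prod_emb_def space_PiM PiE_iff extensional_def restrict_def)
  show "{\<omega>. \<forall>i\<in>F. \<omega> i = (i \<in> S)} \<in> sets (coins p)"
    unfolding eq coins_def using assms(3) by (intro sets_PiM_I) auto
  have "measure (coins p) {\<omega>. \<forall>i\<in>F. \<omega> i = (i \<in> S)} =
    (\<Prod>i\<in>F. measure (measure_pmf (bernoulli_pmf p)) {i \<in> S})"
    unfolding eq coins_def by (rule measure_PiM_emb) (use assms in auto)
  also have "\<dots> = (\<Prod>i\<in>F. if i \<in> S then p else 1 - p)"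
    by (intro prod.cong) (use assms in \<open>auto simp: measure_pmf_single\<close>)
  also have "\<dots> = (\<Prod>i\<in>S. p) * (\<Prod>i\<in>F-S. 1 - p)"
    using assms by (subst prod.subset_diff[of S F]) (auto simp: mult.commute intro!: arg_cong2[where f="(*)"] prod.cong)
  finally show "measure (coins p) {\<omega>. \<forall>i\<in>F. \<omega> i = (i \<in> S)} = p ^ card S * (1 - p) ^ card (F - S)"
    by simp
qed

lemma prob_coin_False:
  fixes z :: "nat \<times> (nat ^ 'n::finite)"
  assumes "0 \<le> p" "p \<le> 1"
  shows "measure (coins p) {\<omega>. \<not> \<omega> z} = 1 - p"
  using cylinder_coins(2)[OF assms, of "{z}" "{}"] by simp

text \<open>Such an event is a finite disjoint union of cylinders, one for each set of coins in
  \<open>F\<close> that may show True.\<close>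

lemma
  fixes F :: "(nat \<times> (nat ^ 'n::finite)) set"
  assumes "0 \<le> p" "p \<le> 1" "finite F" "determined_by F E"
  shows sets_determined: "{\<omega>. E \<omega>} \<in> sets (coins p)"
    and prob_determined: "measure (coins p) {\<omega>. E \<omega>} = bernoulli_sum p F E"
proof -
  let ?C = "\<lambda>S. {\<omega>. \<forall>i\<in>F. \<omega> i = (i \<in> S)}"
  let ?P = "{S\<in>Pow F. E (\<lambda>i. i \<in> S)}"
  have "\<omega> \<in> (\<Union>S\<in>?P. ?C S)" if "E \<omega>" for \<omega>
  proof (rule UN_I[of "{i\<in>F. \<omega> i}"])
    have "E (\<lambda>i. i \<in> {i\<in>F. \<omega> i}) = E \<omega>"
      by (rule determined_byD[OF assms(4)]) auto
    then show "{i\<in>F. \<omega> i} \<in> ?P" using that by auto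
  qed auto
  moreover have "E \<omega>" if "S \<in> ?P" "\<omega> \<in> ?C S" for \<omega> S
    using determined_byD[OF assms(4), of \<omega> "\<lambda>i. i \<in> S"] that by auto
  ultimately have eq: "{\<omega>. E \<omega>} = (\<Union>S\<in>?P. ?C S)" by blast
  have disj: "disjoint_family_on ?C ?P"
    unfolding disjoint_family_on_def
  proof (intro ballI impI)
    fix S T assume "S \<in> ?P" "T \<in> ?P" "S \<noteq> T"
    then obtain i where "i \<in> F" "(i \<in> S) \<noteq> (i \<in> T)" by blast
    then show "?C S \<inter> ?C T = {}" by auto
  qed
  have fin: "finite ?P" using assms(3) by auto
  show "{\<omega>. E \<omega>} \<in> sets (coins p)"
    unfolding eq using cylinder_coins(1)[OF assms(1-3)] fin by (intro sets.finite_UN) auto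
  have "measure (coins p) {\<omega>. E \<omega>} = (\<Sum>S\<in>?P. measure (coins p) (?C S))"
    unfolding eq using cylinder_coins(1)[OF assms(1-3)] fin disj
    by (intro coins.finite_measure_finite_Union) auto
  also have "\<dots> = (\<Sum>S\<in>?P. p ^ card S * (1 - p) ^ card (F - S))"
    using cylinder_coins(2)[OF assms(1-3)] by (intro sum.cong) auto
  also have "\<dots> = bernoulli_sum p F E"
    unfolding bernoulli_sum_def using assms(3)
    by (intro sum.mono_neutral_cong_left) auto
  finally show "measure (coins p) {\<omega>. E \<omega>} = bernoulli_sum p F E" .
qed

section \<open>Bernoulli sums as functions of the parameter and of the coin set\<close>

lemma continuous_on_bernoulli_sum: "continuous_on X (\<lambda>p. bernoulli_sum p F E)"
  unfolding bernoulli_sum_def by (intro continuous_intros)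

text \<open>This is conditioning on coin \<open>i\<close>: subsets of \<open>insert i F\<close> are
  split by whether they contain \<open>i\<close>.\<close>

lemma bernoulli_sum_insert:
  assumes "finite F" "i \<notin> F"
  shows "bernoulli_sum p (insert i F) E =
    p * bernoulli_sum p F (\<lambda>\<omega>. E (fun_upd \<omega> i True)) + (1 - p) * bernoulli_sum p F (\<lambda>\<omega>. E (fun_upd \<omega> i False))"
proof -
  let ?f = "\<lambda>S. of_bool (E (\<lambda>i. i \<in> S)) * (p ^ card S * (1 - p) ^ card (insert i F - S))"
  have "bernoulli_sum p (insert i F) E = (\<Sum>S\<in>Pow F. ?f S) + (\<Sum>S\<in>insert i ` Pow F. ?f S)"
    unfolding bernoulli_sum_def Pow_insert using assms by (intro sum.union_disjoint) auto
  also have "(\<Sum>S\<in>insert i ` Pow F. ?f S) = (\<Sum>S\<in>Pow F. ?f (insert i S))"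
    by (rule sum.reindex_cong[where l="insert i"]) (use assms in \<open>auto simp: inj_on_def\<close>)
  also have "\<dots> = p * bernoulli_sum p F (\<lambda>\<omega>. E (fun_upd \<omega> i True))"
    unfolding bernoulli_sum_def sum_distrib_left
  proof (rule sum.cong)
    fix S assume S: "S \<in> Pow F"
    then have "finite S" "i \<notin> S" using assms finite_subset by auto
    moreover have "(\<lambda>j. j \<in> insert i S) = fun_upd (\<lambda>j. j \<in> S) i True" by (auto simp: fun_eq_iff)
    moreover have "insert i F - insert i S = F - S" using assms by auto
    ultimately show "?f (insert i S) =
      p * (of_bool (E (fun_upd (\<lambda>j. j \<in> S) i True)) * (p ^ card S * (1 - p) ^ card (F - S)))" by simp
  qed simp
  also have "(\<Sum>S\<in>Pow F. ?f S) = (1 - p) * bernoulli_sum p F (\<lambda>\<omega>. E (fun_upd \<omega> i False))"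
    unfolding bernoulli_sum_def sum_distrib_left
  proof (rule sum.cong)
    fix S assume S: "S \<in> Pow F"
    then have "i \<notin> S" using assms by auto
    then have "insert i F - S = insert i (F - S)" "(\<lambda>j. j \<in> S) = fun_upd (\<lambda>j. j \<in> S) i False" by (auto simp: fun_eq_iff)
    moreover have "finite (F - S)" "i \<notin> F - S" using assms by auto
    ultimately show "?f S =
      (1 - p) * (of_bool (E (fun_upd (\<lambda>j. j \<in> S) i False)) * (p ^ card S * (1 - p) ^ card (F - S)))" by simp
  qed simp
  finally show ?thesis by (simp only: add.commute)
qed

lemma bernoulli_sum_mono_event:
  assumes "0 \<le> p" "p \<le> 1" "\<And>\<omega>. E \<omega> \<Longrightarrow> E' \<omega>"
  shows "bernoulli_sum p F E \<le> bernoulli_sum p F E'"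
  unfolding bernoulli_sum_def using assms by (intro sum_mono mult_right_mono) auto

text \<open>Induction on the coins replaces a coupling. Conditioned on coin \<open>i\<close>, an
  increasing event is at least as likely under True as under False, so moving weight
  \<open>q - p\<close> from False to True cannot lower the sum; the other coins are covered by the
  induction hypothesis.\<close>

lemma bernoulli_sum_mono:
  assumes "finite F" "0 \<le> p" "p \<le> q" "q \<le> 1" "increasing_event E"
  shows "bernoulli_sum p F E \<le> bernoulli_sum q F E"
  using assms(1,5)
proof (induction F arbitrary: E rule: finite_induct)
  case empty
  then show ?case by (simp add: bernoulli_sum_def)
next
  case (insert i F)
  let ?a = "\<lambda>p. bernoulli_sum p F (\<lambda>\<omega>. E (fun_upd \<omega> i True))"
  let ?b = "\<lambda>p. bernoulli_sum p F (\<lambda>\<omega>. E (fun_upd \<omega> i False))"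
  have inc: "increasing_event (\<lambda>\<omega>. E (fun_upd \<omega> i b))" for b
    unfolding increasing_event_def
  proof (intro allI impI)
    fix \<omega> \<omega>' :: "'a \<Rightarrow> bool"
    assume le: "\<forall>j. \<omega> j \<longrightarrow> \<omega>' j" and "E (fun_upd \<omega> i b)"
    moreover have "\<forall>j. (fun_upd \<omega> i b) j \<longrightarrow> (fun_upd \<omega>' i b) j" using le by simp
    ultimately show "E (fun_upd \<omega>' i b)" using insert.prems unfolding increasing_event_def by blast
  qed
  have "?b q \<le> ?a q"
  proof (rule bernoulli_sum_mono_event)
    fix \<omega> assume "E (fun_upd \<omega> i False)"
    moreover have "\<forall>j. (fun_upd \<omega> i False) j \<longrightarrow> (fun_upd \<omega> i True) j" by simp
    ultimately show "E (fun_upd \<omega> i True)"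
      using insert.prems unfolding increasing_event_def by blast
  qed (use assms in auto)
  then have "0 \<le> (q - p) * (?a q - ?b q)" using assms by simp
  then have "p * ?a q + (1 - p) * ?b q \<le> q * ?a q + (1 - q) * ?b q" by (simp add: algebra_simps)
  moreover have "p * ?a p + (1 - p) * ?b p \<le> p * ?a q + (1 - p) * ?b q"
    using assms(2-4) by (intro add_mono mult_left_mono insert.IH inc) auto
  ultimately show ?case
    unfolding bernoulli_sum_insert[OF insert.hyps(1,2)] by linarith
qed

text \<open>The coins are exchangeable, so relabelling them leaves the sum unchanged. This is the
  source of translation invariance; injectivity is asked only on \<open>F\<close> because truncated
  translations are not injective globally.\<close>

lemma bernoulli_sum_reindex:
  assumes "finite F" "inj_on \<pi> F" "determined_by F E"
  shows "bernoulli_sum p (\<pi> ` F) (\<lambda>\<omega>. E (\<omega> \<circ> \<pi>)) = bernoulli_sum p F E"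
proof -
  let ?f = "\<lambda>S. of_bool (E ((\<lambda>i. i \<in> S) \<circ> \<pi>)) * (p ^ card S * (1 - p) ^ card (\<pi> ` F - S))"
  have "Pow (\<pi> ` F) = (`) \<pi> ` Pow F"
    by (simp add: image_Pow_surj)
  then have "bernoulli_sum p (\<pi> ` F) (\<lambda>\<omega>. E (\<omega> \<circ> \<pi>)) = (\<Sum>S\<in>(`) \<pi> ` Pow F. ?f S)"
    unfolding bernoulli_sum_def by simp
  also have "\<dots> = (\<Sum>S\<in>Pow F. ?f (\<pi> ` S))"
    by (rule sum.reindex_cong[where l="(`) \<pi>"]) (use assms inj_on_image_Pow in auto)
  also have "\<dots> = bernoulli_sum p F E"
    unfolding bernoulli_sum_def
  proof (rule sum.cong)
    fix S assume "S \<in> Pow F"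
    then have S: "S \<subseteq> F" by simp
    have "E ((\<lambda>i. i \<in> \<pi> ` S) \<circ> \<pi>) = E (\<lambda>i. i \<in> S)"
      by (rule determined_byD[OF assms(3)]) (use S assms(2) in \<open>auto dest: inj_onD\<close>)
    moreover have "card (\<pi> ` S) = card S"
      by (rule card_image) (use S assms(2) inj_on_subset in auto)
    moreover have "card (\<pi> ` F - \<pi> ` S) = card (F - S)"
      by (metis Diff_subset S assms(2) card_image inj_on_image_set_diff inj_on_subset)
    ultimately show "?f (\<pi> ` S) = of_bool (E (\<lambda>i. i \<in> S)) * (p ^ card S * (1 - p) ^ card (F - S))"
      by simp
  qed simp
  finally show ?thesis .
qed

text \<open>Independence: a configuration on \<open>F \<union> G\<close> splits uniquely into one on
  \<open>F\<close> and one on \<open>G\<close>, and the weights multiply.\<close>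

lemma bernoulli_sum_Un:
  assumes "finite F" "finite G" "F \<inter> G = {}" "determined_by F E" "determined_by G E'"
  shows "bernoulli_sum p (F \<union> G) (\<lambda>\<omega>. E \<omega> \<and> E' \<omega>) = bernoulli_sum p F E * bernoulli_sum p G E'"
proof -
  let ?h = "\<lambda>S. of_bool (E (\<lambda>i. i \<in> S) \<and> E' (\<lambda>i. i \<in> S)) * (p ^ card S * (1 - p) ^ card (F \<union> G - S))"
  have "bernoulli_sum p F E * bernoulli_sum p G E' =
    (\<Sum>(S, T)\<in>Pow F \<times> Pow G. (of_bool (E (\<lambda>i. i \<in> S)) * (p ^ card S * (1 - p) ^ card (F - S))) *
       (of_bool (E' (\<lambda>i. i \<in> T)) * (p ^ card T * (1 - p) ^ card (G - T))))"
    unfolding bernoulli_sum_def sum_product sum.cartesian_product by simp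
  also have "\<dots> = (\<Sum>(S, T)\<in>Pow F \<times> Pow G. ?h (S \<union> T))"
  proof (rule sum.cong, simp, clarify)
    fix S T assume S: "S \<subseteq> F" and T: "T \<subseteq> G"
    have "E (\<lambda>i. i \<in> S \<union> T) = E (\<lambda>i. i \<in> S)"
      by (rule determined_byD[OF assms(4)]) (use T assms(3) in auto)
    moreover have "E' (\<lambda>i. i \<in> S \<union> T) = E' (\<lambda>i. i \<in> T)"
      by (rule determined_byD[OF assms(5)]) (use S assms(3) in auto)
    moreover have "card (S \<union> T) = card S + card T"
      using S T assms by (intro card_Un_disjoint) (auto intro: finite_subset)
    moreover have "F \<union> G - (S \<union> T) = (F - S) \<union> (G - T)" using S T assms(3) by auto
    moreover have "card ((F - S) \<union> (G - T)) = card (F - S) + card (G - T)"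
      using assms by (intro card_Un_disjoint) auto
    ultimately show "(of_bool (E (\<lambda>i. i \<in> S)) * (p ^ card S * (1 - p) ^ card (F - S))) *
       (of_bool (E' (\<lambda>i. i \<in> T)) * (p ^ card T * (1 - p) ^ card (G - T))) = ?h (S \<union> T)"
      by (simp add: power_add)
  qed
  also have "\<dots> = (\<Sum>U\<in>Pow (F \<union> G). ?h U)"
    by (rule sum.reindex_bij_witness[where i="\<lambda>U. (U \<inter> F, U \<inter> G)" and j="\<lambda>(S, T). S \<union> T"])
      (use assms(3) in auto)
  finally show ?thesis unfolding bernoulli_sum_def by simp
qed

text \<open>At \<open>p = 0\<close> only the configuration without True coins has nonzero weight.
  Together with continuity this keeps the critical point away from 0.\<close>

lemma bernoulli_sum_0:
  assumes "finite F"
  shows "bernoulli_sum 0 F E = of_bool (E (\<lambda>_. False))"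
proof -
  have "bernoulli_sum 0 F E = (\<Sum>S\<in>{{}}. of_bool (E (\<lambda>i. i \<in> S)) * (0 ^ card S * (1 - 0) ^ card (F - S)))"
    unfolding bernoulli_sum_def
  proof (rule sum.mono_neutral_right)
    show "\<forall>S\<in>Pow F - {{}}. of_bool (E (\<lambda>i. i \<in> S)) * (0 ^ card S * (1 - 0) ^ card (F - S)) = (0 :: real)"
      using assms finite_subset by (auto simp: zero_power card_gt_0_iff)
  qed (use assms in auto)
  then show ?thesis by simp
qed

section \<open>Transfer of the finite sums to probabilities\<close>

lemma prob_mono:
  fixes F :: "(nat \<times> (nat ^ 'n::finite)) set"
  assumes "finite F" "determined_by F E" "increasing_event E" "0 \<le> p" "p \<le> q" "q \<le> 1"
  shows "measure (coins p) {\<omega>. E \<omega>} \<le> measure (coins q) {\<omega>. E \<omega>}"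
  using bernoulli_sum_mono[of F p q E] assms prob_determined[of p F E] prob_determined[of q F E] by simp

lemma prob_reindex:
  fixes F :: "(nat \<times> (nat ^ 'n::finite)) set" and \<pi> :: "nat \<times> (nat ^ 'n) \<Rightarrow> nat \<times> (nat ^ 'n)"
  assumes "0 \<le> p" "p \<le> 1" "finite F" "inj_on \<pi> F" "determined_by F E"
  shows "measure (coins p) {\<omega>. E (\<omega> \<circ> \<pi>)} = measure (coins p) {\<omega>. E \<omega>}"
    and "{\<omega>. E (\<omega> \<circ> \<pi>)} \<in> sets (coins p)"
proof -
  have det: "determined_by (\<pi> ` F) (\<lambda>\<omega>. E (\<omega> \<circ> \<pi>))"
    unfolding determined_by_def by (intro allI impI determined_byD[OF assms(5)]) auto
  show "{\<omega>. E (\<omega> \<circ> \<pi>)} \<in> sets (coins p)"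
    by (rule sets_determined[OF assms(1,2) _ det]) (use assms in auto)
  show "measure (coins p) {\<omega>. E (\<omega> \<circ> \<pi>)} = measure (coins p) {\<omega>. E \<omega>}"
    using prob_determined[OF assms(1,2) _ det] prob_determined[OF assms(1,2,3,5)]
      bernoulli_sum_reindex[OF assms(3-5)] assms(3) by simp
qed

lemma prob_indep:
  fixes F G :: "(nat \<times> (nat ^ 'n::finite)) set"
  assumes "0 \<le> p" "p \<le> 1" "finite F" "finite G" "F \<inter> G = {}" "determined_by F E" "determined_by G E'"
  shows "measure (coins p) {\<omega>. E \<omega> \<and> E' \<omega>} = measure (coins p) {\<omega>. E \<omega>} * measure (coins p) {\<omega>. E' \<omega>}"
  using prob_determined[OF assms(1,2) _ determined_by_conj[OF assms(6,7)]] bernoulli_sum_Un[OF assms(3-7)]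
    prob_determined[OF assms(1,2,3,6)] prob_determined[OF assms(1,2,4,7)] assms(3,4) by simp

lemma prob_all_retained:
  fixes F :: "(nat \<times> (nat ^ 'n::finite)) set"
  assumes "0 \<le> p" "p \<le> 1" "finite F"
  shows "measure (coins p) {\<omega>. \<forall>i\<in>F. \<omega> i} = p ^ card F"
  using cylinder_coins(2)[OF assms, of F] by simp

section \<open>Chains of surviving subcubes\<close>

definition vec_div :: "nat ^ 'n \<Rightarrow> nat \<Rightarrow> nat ^ 'n" where
  "vec_div a m = (\<chi> i. a $ i div m)"

text \<open>For \<open>r = 1\<close> and addresses of the same level this is contact of the closed
  cubes, contact at a corner included.\<close>

definition near :: "nat \<Rightarrow> nat ^ 'n \<Rightarrow> nat ^ 'n \<Rightarrow> bool" where
  "near r a b \<longleftrightarrow> (\<forall>i. a $ i \<le> b $ i + r \<and> b $ i \<le> a $ i + r)"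

definition linked :: "(nat ^ 'n) set \<Rightarrow> nat ^ 'n \<Rightarrow> nat ^ 'n \<Rightarrow> bool" where
  "linked S a b \<longleftrightarrow> a \<in> S \<and> (\<lambda>x y. near 1 x y \<and> y \<in> S)\<^sup>*\<^sup>* a b"

text \<open>All level-\<open>n\<close> cubes of the whole quadrant count as retained here, so that \<open>alive N \<omega> n k\<close>
  depends on the coins of levels \<open>n + 1, \<dots>, n + k\<close> only.\<close>

primrec alive :: "nat \<Rightarrow> (nat \<times> (nat ^ 'n) \<Rightarrow> bool) \<Rightarrow> nat \<Rightarrow> nat \<Rightarrow> (nat ^ 'n) set" where
  "alive N \<omega> n 0 = UNIV"
| "alive N \<omega> n (Suc k) = {a. vec_div a N \<in> alive N \<omega> n k \<and> \<omega> (n + Suc k, a)}"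

text \<open>The translate by \<open>j - c\<close> of the cube \<open>{0..<N ^ n}\<close>, cut off at the coordinate hyperplanes.\<close>

definition block :: "nat \<Rightarrow> nat \<Rightarrow> nat ^ 'n \<Rightarrow> nat ^ 'n \<Rightarrow> (nat ^ 'n) set" where
  "block N n c j = {x. \<forall>i. j $ i \<le> x $ i + c $ i \<and> x $ i + c $ i < j $ i + N ^ n}"

text \<open>The coins that \<open>alive N \<omega> n k\<close> consults for cubes whose
  level-\<open>n\<close> ancestor lies in \<open>B\<close>. Disjoint choices of \<open>B\<close>
  give disjoint coin sets, and every use of independence between windows rests on that.\<close>

definition descendants :: "nat \<Rightarrow> nat \<Rightarrow> nat \<Rightarrow> (nat ^ 'n) set \<Rightarrow> (nat \<times> (nat ^ 'n)) set" where
  "descendants N n k B = {(n + l, b) | l b. 1 \<le> l \<and> l \<le> k \<and> vec_div b (N ^ l) \<in> B}"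

lemma vec_div_nth [simp]: "vec_div a m $ i = a $ i div m"
  by (simp add: vec_div_def)

lemma vec_div_1 [simp]: "vec_div a (Suc 0) = a"
  by (simp add: vec_eq_iff)

lemma vec_div_vec_div: "vec_div (vec_div a m) m' = vec_div a (m * m')"
  by (simp add: vec_eq_iff div_mult2_eq)

lemma near_sym: "near r a b \<longleftrightarrow> near r b a"
  by (auto simp: near_def)

section \<open>Chains of touching cubes\<close>

lemma linked_refl: "a \<in> S \<Longrightarrow> linked S a a"
  by (simp add: linked_def)

lemma linked_mem: "linked S a b \<Longrightarrow> a \<in> S \<and> b \<in> S"
  unfolding linked_def by (auto elim: rtranclp.cases)

lemma linked_step: "linked S a b \<Longrightarrow> near 1 b c \<Longrightarrow> c \<in> S \<Longrightarrow> linked S a c"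
  unfolding linked_def by (auto intro!: rtranclp.rtrancl_into_rtrancl[of _ a b c])

lemma linked_trans: "linked S a b \<Longrightarrow> linked S b c \<Longrightarrow> linked S a c"
  unfolding linked_def by auto

lemma linked_induct [consumes 1, case_names refl step]:
  assumes "linked S a b" "a \<in> S \<Longrightarrow> P a"
    "\<And>b c. linked S a b \<Longrightarrow> near 1 b c \<Longrightarrow> c \<in> S \<Longrightarrow> P b \<Longrightarrow> P c"
  shows "P b"
proof -
  have "(\<lambda>x y. near 1 x y \<and> y \<in> S)\<^sup>*\<^sup>* a b" "a \<in> S" using assms(1) by (auto simp: linked_def)
  then show ?thesis
  proof (induction rule: rtranclp_induct)
    case base
    then show ?case using assms(2) by simp
  next
    case (step y z)
    then show ?case using assms(3)[of y z] by (simp add: linked_def)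
  qed
qed

lemma linked_sym: "linked S a b \<Longrightarrow> linked S b a"
proof (induction rule: linked_induct)
  case refl
  then show ?case by (rule linked_refl)
next
  case (step b c)
  have "linked S c b"
    using linked_step[OF linked_refl[OF step(3)], of b] step near_sym linked_mem by metis
  then show ?case using step(4) linked_trans by metis
qed

lemma linked_image:
  assumes "linked S a b" "\<And>x. x \<in> S \<Longrightarrow> g x \<in> T"
    "\<And>x y. x \<in> S \<Longrightarrow> y \<in> S \<Longrightarrow> near 1 x y \<Longrightarrow> near 1 (g x) (g y)"
  shows "linked T (g a) (g b)"
  using assms(1)
proof (induction rule: linked_induct)
  case refl
  then show ?case using assms(2) linked_refl by metis
next
  case (step b c)
  then show ?case using assms(2,3) linked_step linked_mem by metis
qed

lemma linked_mono: "linked S a b \<Longrightarrow> S \<subseteq> T \<Longrightarrow> linked T a b"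
  using linked_image[of S a b id T] by auto

text \<open>The chain is stopped just before it first leaves \<open>B\<close>. Survival of the first
  cube outside is not recorded, so the event depends on coins below \<open>B\<close> only.\<close>

lemma linked_exit:
  assumes "linked S a c" "a \<in> B" "c \<notin> B"
  shows "\<exists>b c'. linked (S \<inter> B) a b \<and> near 1 b c' \<and> c' \<notin> B"
proof -
  have "linked (S \<inter> B) a c \<or> (\<exists>b c'. linked (S \<inter> B) a b \<and> near 1 b c' \<and> c' \<notin> B)"
    using assms(1)
  proof (induction rule: linked_induct)
    case refl
    then have "a \<in> S \<inter> B" using assms(2) by simp
    from linked_refl[OF this] show ?case using refl by blast
  next
    case (step b c)
    then show ?case using linked_step[of "S \<inter> B" a b c] by blast
  qed
  moreover have "\<not> linked (S \<inter> B) a c" using assms(3) linked_mem[of "S \<inter> B" a c] by blast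
  ultimately show ?thesis by blast
qed

section \<open>Survival and the finite coin sets that decide it\<close>

lemma alive_add: "a \<in> alive N \<omega> n (m + k) \<longleftrightarrow> vec_div a (N ^ k) \<in> alive N \<omega> n m \<and> a \<in> alive N \<omega> (n + m) k"
  by (induction k arbitrary: a) (auto simp: vec_div_vec_div add.assoc)

lemma alive_mono: "(\<And>i. \<omega> i \<Longrightarrow> \<omega>' i) \<Longrightarrow> alive N \<omega> n k \<subseteq> alive N \<omega>' n k"
  by (induction k) auto

lemma retained_cubes_alive:
  "retained_cubes N \<omega> k = {a. vec_div a (N ^ k) = 0 \<and> a \<in> alive N \<omega> 0 k}"
proof (induction k)
  case 0
  then show ?case by (auto simp: vec_eq_iff)
next
  case (Suc k)
  have *: "(\<chi> i. j $ i div N) = vec_div j N" for j :: "nat ^ 'a" by (simp add: vec_div_def)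
  show ?case unfolding retained_cubes.simps * Suc by (auto simp: vec_div_vec_div)
qed

lemma alive_cong:
  assumes "\<And>i. i \<in> descendants N n k B \<Longrightarrow> \<omega> i = \<omega>' i" "vec_div a (N ^ k) \<in> B"
  shows "a \<in> alive N \<omega> n k \<longleftrightarrow> a \<in> alive N \<omega>' n k"
  using assms
proof (induction k arbitrary: a)
  case (Suc k)
  have "vec_div a N \<in> alive N \<omega> n k \<longleftrightarrow> vec_div a N \<in> alive N \<omega>' n k"
  proof (rule Suc.IH)
    fix i assume "i \<in> descendants N n k B"
    then show "\<omega> i = \<omega>' i" by (intro Suc.prems(1)) (auto simp: descendants_def)
  qed (use Suc.prems in \<open>auto simp: vec_div_vec_div\<close>)
  moreover have "(n + Suc k, a) \<in> descendants N n (Suc k) B"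
    unfolding descendants_def using Suc.prems(2) by fastforce
  ultimately show ?case using Suc.prems(1) by auto
qed simp

lemma finite_vec_less: "finite {x :: nat ^ 'n::finite. \<forall>i. x $ i < m}"
proof -
  have "{x :: nat ^ 'n. \<forall>i. x $ i < m} \<subseteq> vec_lambda ` (UNIV \<rightarrow>\<^sub>E {..<m})"
  proof
    fix x :: "nat ^ 'n" assume "x \<in> {x. \<forall>i. x $ i < m}"
    then have "vec_nth x \<in> UNIV \<rightarrow>\<^sub>E {..<m}" by auto
    then show "x \<in> vec_lambda ` (UNIV \<rightarrow>\<^sub>E {..<m})" by (metis image_eqI vec_nth_inverse)
  qed
  then show ?thesis by (rule finite_subset) (intro finite_imageI finite_PiE finite finite_lessThan)
qed

lemma finite_vec_bounded:
  fixes B :: "(nat ^ 'n::finite) set"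
  assumes "\<And>x i. x \<in> B \<Longrightarrow> x $ i < m"
  shows "finite B"
  by (rule finite_subset[OF _ finite_vec_less[of m]]) (use assms in auto)

lemma finite_imp_vec_bounded:
  fixes B :: "(nat ^ 'n::finite) set"
  assumes "finite B"
  shows "\<exists>m. \<forall>x\<in>B. \<forall>i. x $ i < m"
proof -
  have "finite (\<Union>x\<in>B. range (vec_nth x))" using assms by auto
  then obtain m where "\<forall>y\<in>(\<Union>x\<in>B. range (vec_nth x)). y < m"
    unfolding finite_nat_set_iff_bounded by blast
  then show ?thesis by blast
qed

lemma finite_descendants:
  fixes B :: "(nat ^ 'n::finite) set"
  assumes "finite B" "N > 0"
  shows "finite (descendants N n k B)"
proof -
  obtain m where m: "\<forall>x\<in>B. \<forall>i. x $ i < m" using finite_imp_vec_bounded[OF assms(1)] by blast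
  have "finite {b. vec_div b (N ^ l) \<in> B}" for l
  proof (rule finite_vec_bounded)
    fix x i assume "x \<in> {b. vec_div b (N ^ l) \<in> B}"
    then have "vec_div x (N ^ l) $ i < m" using m by blast
    then have "x $ i div N ^ l < m" by simp
    then show "x $ i < m * N ^ l" using assms(2) by (simp add: div_less_iff_less_mult)
  qed
  then have "finite (\<Union>l\<in>{1..k}. Pair (n + l) ` {b. vec_div b (N ^ l) \<in> B})" by auto
  then show ?thesis
    by (rule finite_subset[rotated]) (auto simp: descendants_def)
qed

lemma descendants_disjoint: "B \<inter> B' = {} \<Longrightarrow> descendants N n k B \<inter> descendants N n k B' = {}"
  by (auto simp: descendants_def)

lemma descendantsI: "1 \<le> m \<Longrightarrow> m \<le> k \<Longrightarrow> vec_div b (N ^ m) \<in> B \<Longrightarrow> (n + m, b) \<in> descendants N n k B"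
  unfolding descendants_def by blast

lemma descendants_trans:
  assumes "vec_div b (N ^ m) = c"
  shows "descendants N (n + m) k {b} \<subseteq> descendants N n (k + m) {c}"
proof
  fix z assume "z \<in> descendants N (n + m) k {b}"
  then obtain l a where z: "z = (n + m + l, a)" "1 \<le> l" "l \<le> k" "vec_div a (N ^ l) = b"
    unfolding descendants_def by blast
  have "(n + (m + l), a) \<in> descendants N n (k + m) {c}"
    by (rule descendantsI) (use z assms in \<open>simp_all add: power_add mult.commute flip: vec_div_vec_div\<close>)
  then show "z \<in> descendants N n (k + m) {c}" using z(1) by (simp add: add.assoc)
qed

lemma family_disjoint:
  fixes b c :: "nat ^ 'n"
  assumes "b \<noteq> c"
  shows "({(n, b)} \<union> descendants N n k {b}) \<inter> ({(n, c)} \<union> descendants N n k {c}) = {}"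
proof -
  have "(n, a) \<notin> descendants N n k B" for a :: "nat ^ 'n" and B unfolding descendants_def by simp
  moreover have "descendants N n k {b} \<inter> descendants N n k {c} = {}"
    using assms by (intro descendants_disjoint) simp
  ultimately show ?thesis using assms by (simp add: Int_Un_distrib Int_Un_distrib2)
qed

lemma finite_block: "finite (block N n c (j :: nat ^ 'n::finite))"
proof -
  obtain m where m: "\<forall>i. j $ i < m" using finite_imp_vec_bounded[of "{j}"] by blast
  show ?thesis
  proof (rule finite_vec_bounded[of _ "m + N ^ n"])
    fix x i assume "x \<in> block N n c j"
    then have "x $ i + c $ i < j $ i + N ^ n" by (auto simp: block_def)
    then show "x $ i < m + N ^ n" using m[rule_format, of i] by linarith
  qed
qed

section \<open>From chains to connected components\<close>

lemma mem_subcube: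
  "x \<in> subcube N k j \<longleftrightarrow>
     (\<forall>i. real (j $ i) / real (N ^ k) \<le> x $ i \<and> x $ i \<le> (real (j $ i) + 1) / real (N ^ k))"
  by (auto simp: subcube_def mem_box_cart)

lemma subcube_nonempty:
  assumes "N > 0"
  shows "subcube N k j \<noteq> {}"
proof -
  have "(\<chi> i. real (j $ i) / real (N ^ k)) \<in> subcube N k j"
    using assms by (auto simp: mem_subcube divide_simps)
  then show ?thesis by blast
qed

lemma near_imp_subcubes_meet:
  assumes "N > 0" "near 1 a b"
  shows "subcube N k a \<inter> subcube N k b \<noteq> {}"
proof -
  \<comment> \<open>The coordinatewise maximum of the two lower corners lies in both cubes.\<close>
  let ?x = "\<chi> i. real (max (a $ i) (b $ i)) / real (N ^ k)"
  have "?x \<in> subcube N k a \<inter> subcube N k b"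
    unfolding Int_iff mem_subcube
  proof (intro conjI allI)
    fix i
    have "a $ i \<le> b $ i + 1" "b $ i \<le> a $ i + 1" using assms(2) by (auto simp: near_def)
    then have "real (max (a $ i) (b $ i)) \<le> real (a $ i) + 1" "real (max (a $ i) (b $ i)) \<le> real (b $ i) + 1"
      by linarith+
    then show "?x $ i \<le> (real (a $ i) + 1) / real (N ^ k)" "?x $ i \<le> (real (b $ i) + 1) / real (N ^ k)"
      by (simp_all add: divide_right_mono)
  qed (simp_all add: divide_right_mono)
  then show ?thesis by blast
qed

lemma subcubes_meet_imp_near:
  assumes "N > 0" "x \<in> subcube N k a" "x \<in> subcube N k b"
  shows "near 1 a b"
proof -
  have K: "real (N ^ k) > 0" using assms by simp
  have "a $ i \<le> b $ i + 1 \<and> b $ i \<le> a $ i + 1" for i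
  proof -
    have "real (a $ i) / real (N ^ k) \<le> (real (b $ i) + 1) / real (N ^ k)"
      "real (b $ i) / real (N ^ k) \<le> (real (a $ i) + 1) / real (N ^ k)"
      using assms(2,3) unfolding mem_subcube by (meson order_trans)+
    then have "real (a $ i) \<le> real (b $ i) + 1" "real (b $ i) \<le> real (a $ i) + 1"
      using K by (simp_all only: divide_le_cancel)
    then show ?thesis by linarith
  qed
  then show ?thesis by (simp add: near_def)
qed

lemma connected_subcube: "connected (subcube N k j)"
  unfolding subcube_def by (intro convex_connected convex_box)

lemma compact_subcube: "compact (subcube N k j)"
  unfolding subcube_def by (rule compact_cbox)

lemma linked_imp_connected_component:
  assumes "N > 0" "linked S a b" "x \<in> subcube N k a" "y \<in> subcube N k b"
  shows "connected_component (\<Union>j\<in>S. subcube N k j) x y"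
  using assms(2,4)
proof (induction arbitrary: y rule: linked_induct)
  case refl
  then show ?case
    using connected_subcube[of N k a] assms(3) unfolding connected_component_def by blast
next
  case (step b c)
  obtain z where z: "z \<in> subcube N k b" "z \<in> subcube N k c"
    using near_imp_subcubes_meet[OF assms(1) step(2)] by blast
  have "connected_component (\<Union>j\<in>S. subcube N k j) z y"
    using connected_subcube[of N k c] z step(3,5) unfolding connected_component_def by blast
  then show ?case using step(4)[OF z(1)] connected_component_trans by metis
qed

text \<open>The cubes reachable from \<open>a\<close> and the remaining cubes of \<open>S\<close>
  have closed unions, as \<open>S\<close> is finite, and these are disjoint, as touching cubes are
  linked. A connected set covered by both unions and meeting the first must avoid the
  second.\<close>

lemma connected_imp_linked:
  fixes C :: "(real ^ 'n::finite) set"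
  assumes "N > 0" "finite S" "connected C" "C \<subseteq> (\<Union>j\<in>S. subcube N k j)" "x \<in> C" "y \<in> C"
  shows "\<exists>a b. x \<in> subcube N k a \<and> y \<in> subcube N k b \<and> linked S a b"
proof -
  obtain a where a: "a \<in> S" "x \<in> subcube N k a" using assms by blast
  let ?U = "\<Union>j\<in>{j\<in>S. linked S a j}. subcube N k j"
  let ?V = "\<Union>j\<in>{j\<in>S. \<not> linked S a j}. subcube N k j"
  have closed: "closed (\<Union>j\<in>{j\<in>S. Q j}. subcube N k j)" for Q
    using assms(2) compact_imp_closed[OF compact_subcube] by (intro closed_UN) auto
  have "?U \<inter> ?V = {}"
  proof (rule ccontr)
    assume "?U \<inter> ?V \<noteq> {}"
    then obtain z j j' where z: "z \<in> subcube N k j" "z \<in> subcube N k j'"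
      and j: "linked S a j" "j' \<in> S" "\<not> linked S a j'"
      by blast
    have "near 1 j j'" by (rule subcubes_meet_imp_near[OF assms(1) z])
    then show False using linked_step[OF j(1) _ j(2)] j(3) by simp
  qed
  then have disj: "?U \<inter> ?V \<inter> C = {}" by simp
  have cover: "C \<subseteq> ?U \<union> ?V"
  proof
    fix z assume "z \<in> C"
    then obtain j where "j \<in> S" "z \<in> subcube N k j" using assms(4) by blast
    then show "z \<in> ?U \<union> ?V" by (cases "linked S a j") auto
  qed
  have "x \<in> ?U" using a linked_refl[OF a(1)] by auto
  then have "?V \<inter> C = {}"
    using connected_closedD[OF assms(3) disj cover closed closed] assms(5) disjoint_iff by metis
  then have "y \<notin> ?V" using assms(6) disjoint_iff by metis
  with subsetD[OF cover assms(6)] have "y \<in> ?U" by (meson UnE)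
  then obtain b where "linked S a b" "y \<in> subcube N k b" by auto
  then show ?thesis using a(2) by auto
qed

lemma retained_cubes_less:
  assumes "N > 0" "a \<in> retained_cubes N \<omega> k"
  shows "a $ i < N ^ k"
proof -
  have "vec_div a (N ^ k) $ i = 0" using assms(2) unfolding retained_cubes_alive by simp
  then show ?thesis using assms(1) by (simp add: div_eq_0_iff)
qed

lemma finite_retained_cubes: "N > 0 \<Longrightarrow> finite (retained_cubes N \<omega> k :: (nat ^ 'n::finite) set)"
  by (rule finite_vec_bounded[OF retained_cubes_less])

lemma compact_retained_set: "N > 0 \<Longrightarrow> compact (retained_set N \<omega> k :: (real ^ 'n::finite) set)"
  unfolding retained_set_def by (intro compact_UN finite_retained_cubes compact_subcube)

lemma subcube_subset_parent:
  assumes "N > 0"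
  shows "subcube N (l + k) a \<subseteq> subcube N l (vec_div a (N ^ k))"
proof
  fix x assume x: "x \<in> subcube N (l + k) a"
  have K: "real (N ^ k) > 0" "real (N ^ l) > 0" using assms by auto
  show "x \<in> subcube N l (vec_div a (N ^ k))"
    unfolding mem_subcube
  proof (intro allI conjI)
    fix i
    have 1: "real (a $ i) / real (N ^ (l + k)) \<le> x $ i" "x $ i \<le> (real (a $ i) + 1) / real (N ^ (l + k))"
      using x by (auto simp: mem_subcube)
    have "a $ i div N ^ k * N ^ k \<le> a $ i" by simp
    then have "real (a $ i div N ^ k) * real (N ^ k) \<le> real (a $ i)"
      unfolding of_nat_le_iff[symmetric, where 'a = real] by simp
    then have "real (a $ i div N ^ k) / real (N ^ l) \<le> real (a $ i) / real (N ^ (l + k))"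
      using K by (simp add: power_add field_simps)
    then show "real (vec_div a (N ^ k) $ i) / real (N ^ l) \<le> x $ i" using 1 by simp
    have "a $ i < (a $ i div N ^ k + 1) * N ^ k"
      using assms by (subst div_less_iff_less_mult[symmetric]) auto
    then have "a $ i + 1 \<le> (a $ i div N ^ k + 1) * N ^ k" by simp
    then have "real (a $ i) + 1 \<le> (real (a $ i div N ^ k) + 1) * real (N ^ k)"
      unfolding of_nat_le_iff[symmetric, where 'a = real] by (simp add: algebra_simps)
    then have "(real (a $ i) + 1) / real (N ^ k) \<le> real (a $ i div N ^ k) + 1"
      using K(1) by (simp only: pos_divide_le_eq)
    then have "(real (a $ i) + 1) / real (N ^ k) / real (N ^ l) \<le> (real (a $ i div N ^ k) + 1) / real (N ^ l)"
      using K(2) by (intro divide_right_mono) auto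
    then have "(real (a $ i) + 1) / real (N ^ (l + k)) \<le> (real (a $ i div N ^ k) + 1) / real (N ^ l)"
      by (simp add: power_add mult.commute)
    then show "x $ i \<le> (real (vec_div a (N ^ k) $ i) + 1) / real (N ^ l)" using 1 by simp
  qed
qed

lemma retained_set_antimono:
  assumes "N > 0" "l \<le> m"
  shows "retained_set N \<omega> m \<subseteq> retained_set N \<omega> l"
proof -
  have "retained_set N \<omega> (l + k) \<subseteq> retained_set N \<omega> l" for k
  proof
    fix x assume "x \<in> retained_set N \<omega> (l + k)"
    then obtain a where a: "a \<in> retained_cubes N \<omega> (l + k)" "x \<in> subcube N (l + k) a"
      unfolding retained_set_def by blast
    then have "vec_div a (N ^ k) \<in> retained_cubes N \<omega> l"
      unfolding retained_cubes_alive by (simp add: alive_add vec_div_vec_div power_add mult.commute)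
    then show "x \<in> retained_set N \<omega> l"
      using subcube_subset_parent[OF assms(1)] a(2) unfolding retained_set_def by blast
  qed
  then show ?thesis using assms(2) by (auto dest!: le_Suc_ex)
qed

lemma limit_set_eq:
  assumes "N > 0"
  shows "limit_set N \<omega> = (\<Inter>k. retained_set N \<omega> k)"
proof -
  have "limit_set N \<omega> \<subseteq> retained_set N \<omega> k" for k
  proof -
    have "limit_set N \<omega> \<subseteq> retained_set N \<omega> (k + 1)" unfolding limit_set_def by (rule INF_lower) simp
    then show ?thesis using retained_set_antimono[OF assms, of k "k + 1"] by auto
  qed
  then show ?thesis unfolding limit_set_def by blast
qed

text \<open>Every component meets some \<open>D j\<close>, and by connectedness it is then the
  component of a point chosen once and for all from \<open>D j\<close>. So there are at most as many
  components as indices.\<close>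

lemma components_finite_UN_connected:
  assumes "finite S" "\<And>j. j \<in> S \<Longrightarrow> connected (D j)"
  shows "finite (components (\<Union>j\<in>S. D j))"
proof -
  let ?K = "\<Union>j\<in>S. D j"
  have "components ?K \<subseteq> (\<lambda>j. connected_component_set ?K (SOME x. x \<in> D j)) ` S"
  proof
    fix C assume "C \<in> components ?K"
    then obtain x where x: "x \<in> ?K" "C = connected_component_set ?K x" by (auto simp: components_def)
    then obtain j where j: "j \<in> S" "x \<in> D j" by blast
    then have "(SOME x. x \<in> D j) \<in> D j" by (intro someI[of "\<lambda>x. x \<in> D j"])
    then have "connected_component ?K x (SOME x. x \<in> D j)"
      using j assms(2) unfolding connected_component_def by blast
    then show "C \<in> (\<lambda>j. connected_component_set ?K (SOME x. x \<in> D j)) ` S"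
      using x(2) j(1) connected_component_eq[of "SOME x. x \<in> D j" ?K x] by auto
  qed
  then show ?thesis using assms(1) finite_surj by blast
qed

text \<open>The pairs of \<open>A \<times> B\<close> joined inside \<open>K k\<close> form a compact set, because \<open>K k\<close> has finitely many
  components; a pair common to all \<open>k\<close> is joined by the intersection of the nested components.\<close>

lemma nested_connection:
  fixes K :: "nat \<Rightarrow> ('a::euclidean_space) set"
  assumes K: "\<And>k. compact (K k)" "\<And>k. finite (components (K k))" "\<And>l m. l \<le> m \<Longrightarrow> K m \<subseteq> K l"
    and AB: "closed A" "closed B"
    and conn: "\<And>k. \<exists>a\<in>A. \<exists>b\<in>B. connected_component (K k) a b"
  shows "\<exists>a\<in>A. \<exists>b\<in>B. connected_component (\<Inter>k. K k) a b"
proof -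
  define P where "P k = {(a, b). a \<in> A \<and> b \<in> B \<and> connected_component (K k) a b}" for k
  have P_eq: "P k = (\<Union>C\<in>components (K k). (C \<inter> A) \<times> (C \<inter> B))" for k
  proof (intro equalityI subsetI)
    fix z assume "z \<in> P k"
    then obtain a b where z: "z = (a, b)" "a \<in> A" "b \<in> B" "connected_component (K k) a b"
      by (auto simp: P_def)
    then have "a \<in> K k" by (meson connected_component_in)
    then have "a \<in> connected_component_set (K k) a" "connected_component_set (K k) a \<in> components (K k)"
      by (auto simp: components_def)
    then show "z \<in> (\<Union>C\<in>components (K k). (C \<inter> A) \<times> (C \<inter> B))" using z by blast
  next
    fix z assume "z \<in> (\<Union>C\<in>components (K k). (C \<inter> A) \<times> (C \<inter> B))"
    then obtain C a b where "C \<in> components (K k)" "z = (a, b)" "a \<in> C \<inter> A" "b \<in> C \<inter> B" by blast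
    moreover from this have "connected_component (K k) a b"
      using in_components_connected in_components_subset unfolding connected_component_def by blast
    ultimately show "z \<in> P k" unfolding P_def by blast
  qed
  have comp: "compact C" if "C \<in> components (K k)" for C k
    using closed_components[OF compact_imp_closed[OF K(1)] that] K(1) in_components_subset[OF that]
    by (metis compact_Int_closed inf.absorb_iff2)
  have "compact (P k)" for k
    unfolding P_eq using comp AB K(2)
    by (intro compact_UN compact_Times compact_Int_closed) auto
  moreover have "P k \<noteq> {}" for k using conn[of k] by (auto simp: P_def)
  moreover have "P m \<subseteq> P l" if "l \<le> m" for l m
    using connected_component_of_subset K(3)[OF that] unfolding P_def by blast
  ultimately have "\<Inter>(range P) \<noteq> {}" by (rule compact_nest)
  then obtain a b where ab: "\<And>k. (a, b) \<in> P k" by auto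
  let ?C = "\<lambda>k. connected_component_set (K k) a"
  have aK: "a \<in> K k" for k using ab[of k] unfolding P_def by (auto dest: connected_component_in)
  have "connected (\<Inter>(range ?C))"
  proof (rule connected_nest)
    show "compact (?C k)" for k using aK[of k] by (intro comp[of _ k]) (auto simp: components_def)
    show "connected (?C k)" for k by simp
    show "?C m \<subseteq> ?C l" if "l \<le> m" for l m using K(3)[OF that] by (rule connected_component_mono)
  qed
  moreover have "\<Inter>(range ?C) \<subseteq> (\<Inter>k. K k)" using connected_component_subset by blast
  moreover have "a \<in> \<Inter>(range ?C)" using aK by auto
  moreover have "b \<in> \<Inter>(range ?C)" using ab by (auto simp: P_def)
  ultimately have "connected_component (\<Inter>k. K k) a b" unfolding connected_component_def by blast
  moreover have "a \<in> A" "b \<in> B" using ab[of 0] by (auto simp: P_def)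
  ultimately show ?thesis by blast
qed

text \<open>Connections at arbitrarily deep levels suffice because the retained sets are nested. The
  construction for \<open>p\<close> near 1 produces them at even levels.\<close>

lemma limit_set_connection:
  fixes A B :: "(real ^ 'n::finite) set"
  assumes "N > 0" "closed A" "closed B"
    and conn: "\<And>k. \<exists>m\<ge>k. \<exists>a\<in>A. \<exists>b\<in>B. connected_component (retained_set N \<omega> m) a b"
  shows "\<exists>a\<in>A. \<exists>b\<in>B. connected_component (limit_set N \<omega>) a b"
  unfolding limit_set_eq[OF assms(1)]
proof (rule nested_connection)
  show "compact (retained_set N \<omega> k)" for k by (rule compact_retained_set[OF assms(1)])
  show "finite (components (retained_set N \<omega> k))" for k
    unfolding retained_set_def
    by (intro components_finite_UN_connected finite_retained_cubes assms connected_subcube)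
  show "\<exists>a\<in>A. \<exists>b\<in>B. connected_component (retained_set N \<omega> k) a b" for k
    using conn[of k] connected_component_of_subset[OF _ retained_set_antimono[OF assms(1)]] by blast
  show "retained_set N \<omega> m \<subseteq> retained_set N \<omega> l" if "l \<le> m" for l m
    by (rule retained_set_antimono[OF assms(1) that])
qed (use assms in auto)

section \<open>Total disconnectedness and annulus crossings through pairs of points\<close>

lemma connected_component_iff_components:
  "(\<exists>a\<in>A. \<exists>b\<in>B. connected_component S a b) \<longleftrightarrow> (\<exists>C\<in>components S. C \<inter> A \<noteq> {} \<and> C \<inter> B \<noteq> {})"
proof
  assume "\<exists>a\<in>A. \<exists>b\<in>B. connected_component S a b"
  then obtain a b where ab: "a \<in> A" "b \<in> B" "connected_component S a b" by blast
  show "\<exists>C\<in>components S. C \<inter> A \<noteq> {} \<and> C \<inter> B \<noteq> {}"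
  proof (rule bexI)
    have "a \<in> connected_component_set S a \<inter> A" "b \<in> connected_component_set S a \<inter> B"
      using connected_component_in(1)[OF ab(3)] ab by simp_all
    then show "connected_component_set S a \<inter> A \<noteq> {} \<and> connected_component_set S a \<inter> B \<noteq> {}"
      by (metis empty_iff)
    show "connected_component_set S a \<in> components S"
      using connected_component_in[OF ab(3)] by (simp add: componentsI)
  qed
next
  assume "\<exists>C\<in>components S. C \<inter> A \<noteq> {} \<and> C \<inter> B \<noteq> {}"
  then obtain C where C: "C \<in> components S" "C \<inter> A \<noteq> {}" "C \<inter> B \<noteq> {}" by blast
  then obtain a b where ab: "a \<in> C" "a \<in> A" "b \<in> C" "b \<in> B" by auto
  then have "connected_component S a b"
    using in_components_connected[OF C(1)] in_components_subset[OF C(1)]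
    unfolding connected_component_def by auto
  then show "\<exists>a\<in>A. \<exists>b\<in>B. connected_component S a b" using ab by auto
qed

lemma totally_disconnected_iff:
  "totally_disconnected S \<longleftrightarrow> (\<forall>x y. connected_component S x y \<longrightarrow> x = y)"
proof
  assume td: "totally_disconnected S"
  show "\<forall>x y. connected_component S x y \<longrightarrow> x = y"
  proof (intro allI impI)
    fix x y assume "connected_component S x y"
    then obtain C where "C \<in> components S" "x \<in> C" "y \<in> C"
      using connected_component_iff_components[of "{x}" "{y}" S] by blast
    moreover from this obtain z where "C = {z}" using td unfolding totally_disconnected_def by blast
    ultimately show "x = y" by simp
  qed
next
  assume *: "\<forall>x y. connected_component S x y \<longrightarrow> x = y"
  show "totally_disconnected S"
    unfolding totally_disconnected_def
  proof
    fix C assume C: "C \<in> components S"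
    then obtain x where "x \<in> C" using in_components_nonempty by blast
    moreover have "y = x" if "y \<in> C" for y
    proof -
      have "connected_component S x y"
        using C in_components_connected[OF C] in_components_subset[OF C] that \<open>x \<in> C\<close>
        unfolding connected_component_def by blast
      then show ?thesis using * by blast
    qed
    ultimately have "C = {x}" by blast
    then show "\<exists>x. C = {x}" by blast
  qed
qed

lemma crosses_annulus_antimono:
  assumes "S \<subseteq> T" "crosses_annulus S"
  shows "crosses_annulus T"
  using assms unfolding crosses_annulus_def connected_component_iff_components[symmetric]
  using connected_component_of_subset by blast

text \<open>By compactness the infinite-volume crossing is a countable intersection of events on
  finitely many coins. This gives its measurability and exhibits its probability as a decreasing
  limit.\<close>

lemma crosses_annulus_limit_set:
  fixes \<omega> :: "nat \<times> (nat ^ 'n::finite) \<Rightarrow> bool"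
  assumes "N > 0"
  shows "crosses_annulus (limit_set N \<omega>) \<longleftrightarrow> (\<forall>k. crosses_annulus (retained_set N \<omega> k))"
proof
  assume "crosses_annulus (limit_set N \<omega>)"
  then show "\<forall>k. crosses_annulus (retained_set N \<omega> k)"
    using crosses_annulus_antimono[of "limit_set N \<omega>"] unfolding limit_set_eq[OF assms]
    by (meson INF_lower UNIV_I)
next
  assume "\<forall>k. crosses_annulus (retained_set N \<omega> k)"
  then show "crosses_annulus (limit_set N \<omega>)"
    unfolding crosses_annulus_def connected_component_iff_components[symmetric]
    by (intro limit_set_connection assms) (auto simp: inner_boundary_def outer_boundary_def)
qed

section \<open>The finite-size criterion\<close>

text \<open>Each coordinate is \<open>N ^ 3 / 3\<close> rounded up, so the level-3 cube at this
  address is the lowest one inside the middle third.\<close>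

definition centre :: "nat \<Rightarrow> nat ^ 'n" where
  "centre N = (\<chi> i. (N ^ 3 + 2) div 3)"

text \<open>The event whose probability is \<open>u p k\<close>. Levels up to 3 are taken as
  retained; the last clause says that the final cube touches a face of the unit cube.\<close>

definition spans :: "nat \<Rightarrow> (nat \<times> (nat ^ 'n) \<Rightarrow> bool) \<Rightarrow> nat \<Rightarrow> bool" where
  "spans N \<omega> k \<longleftrightarrow>
     (\<exists>a b. vec_div a (N ^ k) = centre N \<and>
        linked (alive N \<omega> 3 k \<inter> {x. vec_div x (N ^ k) \<in> {y. \<forall>i. y $ i < N ^ 3}}) a b \<and>
        (\<exists>i. b $ i = 0 \<or> b $ i = N ^ 3 * N ^ k - 1))"

text \<open>The same crossing seen from a level-\<open>n\<close> cube \<open>j\<close>, in a window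
  placed so that \<open>j\<close> occupies the position of \<open>centre N\<close>. Success means
  stepping out of the window, so faces cut off by the coordinate hyperplanes need no special case:
  no address lies beyond them.\<close>

definition escapes :: "nat \<Rightarrow> (nat \<times> (nat ^ 'n) \<Rightarrow> bool) \<Rightarrow> nat \<Rightarrow> nat \<Rightarrow> nat ^ 'n \<Rightarrow> bool" where
  "escapes N \<omega> n k j \<longleftrightarrow>
     (\<exists>a b c. vec_div a (N ^ k) = j \<and>
        linked (alive N \<omega> n k \<inter> {x. vec_div x (N ^ k) \<in> block N 3 (centre N) j}) a b \<and>
        near 1 b c \<and> vec_div c (N ^ k) \<notin> block N 3 (centre N) j)"

definition span_prob :: "'n::finite itself \<Rightarrow> nat \<Rightarrow> real \<Rightarrow> nat \<Rightarrow> real" where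
  "span_prob _ N p k = measure (coins p) {\<omega> :: nat \<times> (nat ^ 'n) \<Rightarrow> bool. spans N \<omega> k}"

text \<open>The first two bounds keep a full level-3 cube between the central cube and each face;
  the last two place it in the middle third.\<close>

lemma centre_bounds:
  assumes "N \<ge> 2"
  shows "1 \<le> centre N $ i" "centre N $ i + 2 \<le> N ^ 3"
    "N ^ 3 \<le> 3 * centre N $ i" "3 * (centre N $ i + 1) \<le> 2 * N ^ 3"
proof -
  have "(2::nat) ^ 3 \<le> N ^ 3" using assms by (intro power_mono) auto
  then have "8 \<le> N ^ 3" by simp
  then show "1 \<le> centre N $ i" "centre N $ i + 2 \<le> N ^ 3"
    "N ^ 3 \<le> 3 * centre N $ i" "3 * (centre N $ i + 1) \<le> 2 * N ^ 3"
    by (simp_all add: centre_def)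
qed

lemma alive_Int_cong:
  assumes "\<forall>i\<in>descendants N n k B. \<omega> i = \<omega>' i"
  shows "alive N \<omega> n k \<inter> {x. vec_div x (N ^ k) \<in> B} = alive N \<omega>' n k \<inter> {x. vec_div x (N ^ k) \<in> B}"
  using alive_cong[of N n k B \<omega> \<omega>'] assms by auto

lemma determined_by_spans:
  "determined_by (descendants N 3 k {y. \<forall>i. y $ i < N ^ 3}) (\<lambda>\<omega>. spans N \<omega> k)"
  unfolding determined_by_def spans_def
proof (intro allI impI)
  fix \<omega> \<omega>' :: "nat \<times> (nat ^ 'a) \<Rightarrow> bool"
  let ?B = "{y. \<forall>i. y $ i < N ^ 3}"
  assume "\<forall>i\<in>descendants N 3 k ?B. \<omega> i = \<omega>' i"
  from alive_Int_cong[OF this]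
  show "(\<exists>a b. vec_div a (N ^ k) = centre N \<and>
        linked (alive N \<omega> 3 k \<inter> {x. vec_div x (N ^ k) \<in> ?B}) a b \<and>
        (\<exists>i. b $ i = 0 \<or> b $ i = N ^ 3 * N ^ k - 1)) =
    (\<exists>a b. vec_div a (N ^ k) = centre N \<and>
        linked (alive N \<omega>' 3 k \<inter> {x. vec_div x (N ^ k) \<in> ?B}) a b \<and>
        (\<exists>i. b $ i = 0 \<or> b $ i = N ^ 3 * N ^ k - 1))"
    by simp
qed

lemma determined_by_escapes:
  "determined_by (descendants N n k (block N 3 (centre N) j)) (\<lambda>\<omega>. escapes N \<omega> n k j)"
  unfolding determined_by_def escapes_def
proof (intro allI impI)
  fix \<omega> \<omega>' :: "nat \<times> (nat ^ 'a) \<Rightarrow> bool"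
  assume "\<forall>i\<in>descendants N n k (block N 3 (centre N) j). \<omega> i = \<omega>' i"
  from alive_Int_cong[OF this]
  show "(\<exists>a b c. vec_div a (N ^ k) = j \<and>
        linked (alive N \<omega> n k \<inter> {x. vec_div x (N ^ k) \<in> block N 3 (centre N) j}) a b \<and>
        near 1 b c \<and> vec_div c (N ^ k) \<notin> block N 3 (centre N) j) =
    (\<exists>a b c. vec_div a (N ^ k) = j \<and>
        linked (alive N \<omega>' n k \<inter> {x. vec_div x (N ^ k) \<in> block N 3 (centre N) j}) a b \<and>
        near 1 b c \<and> vec_div c (N ^ k) \<notin> block N 3 (centre N) j)"
    by simp
qed

text \<open>Depth 1 is the smallest at which \<open>spans\<close> consults a coin at all.\<close>

lemma not_spans_False: "\<not> spans N (\<lambda>_. False) 1"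
  unfolding spans_def by (auto dest: linked_mem)

lemma increasing_spans: "increasing_event (\<lambda>\<omega>. spans N \<omega> k)"
  unfolding increasing_event_def spans_def
proof (intro allI impI)
  fix \<omega> \<omega>' :: "nat \<times> (nat ^ 'a) \<Rightarrow> bool"
  let ?B = "{x. vec_div x (N ^ k) \<in> {y. \<forall>i. y $ i < N ^ 3}}"
  assume "\<forall>i. \<omega> i \<longrightarrow> \<omega>' i"
  then have sub: "alive N \<omega> 3 k \<inter> ?B \<subseteq> alive N \<omega>' 3 k \<inter> ?B" using alive_mono[of \<omega> \<omega>'] by blast
  assume "\<exists>a b. vec_div a (N ^ k) = centre N \<and> linked (alive N \<omega> 3 k \<inter> ?B) a b \<and>
        (\<exists>i. b $ i = 0 \<or> b $ i = N ^ 3 * N ^ k - 1)"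
  then show "\<exists>a b. vec_div a (N ^ k) = centre N \<and> linked (alive N \<omega>' 3 k \<inter> ?B) a b \<and>
        (\<exists>i. b $ i = 0 \<or> b $ i = N ^ 3 * N ^ k - 1)"
    using linked_mono[OF _ sub] by blast
qed

section \<open>Measurability and monotonicity of the crossing events\<close>

lemma sets_spans:
  assumes "N > 0" "0 \<le> p" "p \<le> 1"
  shows "{\<omega> :: nat \<times> (nat ^ 'n::finite) \<Rightarrow> bool. spans N \<omega> k} \<in> sets (coins p)"
  by (rule sets_determined[OF assms(2,3) _ determined_by_spans])
    (use assms in \<open>auto intro!: finite_descendants finite_vec_less\<close>)

lemma span_prob_eq:
  assumes "N > 0" "0 \<le> p" "p \<le> 1"
  shows "span_prob TYPE('n::finite) N p k =
    bernoulli_sum p (descendants N 3 k {y :: nat ^ 'n. \<forall>i. y $ i < N ^ 3}) (\<lambda>\<omega>. spans N \<omega> k)"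
  unfolding span_prob_def
  by (rule prob_determined[OF assms(2,3) _ determined_by_spans])
    (use assms in \<open>auto intro!: finite_descendants finite_vec_less\<close>)

lemma span_prob_mono:
  assumes "N > 0" "0 \<le> p" "p \<le> q" "q \<le> 1"
  shows "span_prob TYPE('n::finite) N p k \<le> span_prob TYPE('n) N q k"
  unfolding span_prob_def
  by (rule prob_mono[OF _ determined_by_spans increasing_spans])
    (use assms in \<open>auto intro!: finite_descendants finite_vec_less\<close>)

lemma sets_escapes:
  assumes "N > 0" "0 \<le> p" "p \<le> 1"
  shows "{\<omega> :: nat \<times> (nat ^ 'n::finite) \<Rightarrow> bool. escapes N \<omega> n k j} \<in> sets (coins p)"
  by (rule sets_determined[OF assms(2,3) _ determined_by_escapes])
    (use assms in \<open>auto intro!: finite_descendants finite_block\<close>)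

lemma escapesI:
  assumes "N \<ge> 2" "linked (alive N \<omega> n k) a b"
    "vec_div b (N ^ k) \<notin> block N 3 (centre N) (vec_div a (N ^ k))"
  shows "escapes N \<omega> n k (vec_div a (N ^ k))"
proof -
  let ?B = "{x. vec_div x (N ^ k) \<in> block N 3 (centre N) (vec_div a (N ^ k))}"
  have "centre N $ i < N ^ 3" for i :: 'a
    using centre_bounds(2)[OF assms(1), of i] by linarith
  then have "a \<in> ?B" by (simp add: block_def)
  from linked_exit[OF assms(2) this] assms(3) show ?thesis unfolding escapes_def by auto
qed

text \<open>Moves cube \<open>j\<close> to cube \<open>v\<close>, measured \<open>l\<close> levels
  further down, hence the factor \<open>N ^ l\<close>. Adding before subtracting means that with
  \<open>v = centre N\<close> no truncation occurs on descendants of the window around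
  \<open>j\<close>.\<close>

definition translate :: "nat \<Rightarrow> nat ^ 'n \<Rightarrow> nat ^ 'n \<Rightarrow> nat \<Rightarrow> nat ^ 'n \<Rightarrow> nat ^ 'n" where
  "translate N v j l b = (\<chi> i. b $ i + N ^ l * v $ i - N ^ l * j $ i)"

lemma translate_nth: "translate N v j l b $ i = b $ i + N ^ l * v $ i - N ^ l * j $ i"
  by (simp add: translate_def)

lemma near_translate:
  assumes "near 1 a b"
  shows "near 1 (translate N v j l a) (translate N v j l b)"
proof -
  have "x + u - w \<le> y + u - w + 1" if "x \<le> y + 1" for x y u w :: nat
    using that by linarith
  then show ?thesis using assms unfolding near_def translate_nth by blast
qed

text \<open>Holds under truncation as well: if \<open>m * y\<close> exceeds \<open>x\<close>, both
  sides are 0.\<close>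

lemma diff_mult_div:
  fixes x y m :: nat
  assumes "m > 0"
  shows "(x - m * y) div m = x div m - y"
proof (cases "m * y \<le> x")
  case True
  then obtain r where "x = m * y + r" using le_Suc_ex by blast
  then show ?thesis using assms by simp
next
  case False
  then have "x < y * m" by (simp add: mult.commute)
  then have "x div m < y" by (rule less_mult_imp_div_less)
  then show ?thesis using False by simp
qed

lemma translate_div:
  assumes "N > 0"
  shows "vec_div (translate N v j (k + l) a) (N ^ k) = translate N v j l (vec_div a (N ^ k))"
proof -
  have "(a $ i + N ^ (k + l) * v $ i - N ^ (k + l) * j $ i) div N ^ k =
      a $ i div N ^ k + N ^ l * v $ i - N ^ l * j $ i" for i
    using assms diff_mult_div[of "N ^ k" "a $ i + N ^ k * (N ^ l * v $ i)" "N ^ l * j $ i"]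
    by (simp add: power_add mult.assoc)
  then show ?thesis by (simp add: vec_eq_iff translate_nth)
qed

text \<open>Truncated subtraction in \<open>translate\<close> is harmless here: by \<open>translate_div\<close> it commutes with
  passing to the ancestor.\<close>

lemma alive_translate:
  assumes "N > 0"
  shows "a \<in> alive N (\<lambda>(l, b). \<omega> (l - n + m, translate N v j (l - n) b)) n k \<longleftrightarrow>
    translate N v j k a \<in> alive N \<omega> m k"
proof (induction k arbitrary: a)
  case (Suc k)
  show ?case using Suc[of "vec_div a N"] translate_div[OF assms, of v j 1 k a] by (simp add: add.commute)
qed simp

lemma block_coord_bounds:
  assumes "N > 0" "vec_div b (N ^ l) \<in> block N 3 c j"
  shows "N ^ l * j $ i \<le> b $ i + N ^ l * c $ i" "b $ i + N ^ l * c $ i < N ^ l * j $ i + N ^ 3 * N ^ l"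
proof -
  have 1: "j $ i \<le> b $ i div N ^ l + c $ i" "b $ i div N ^ l + c $ i + 1 \<le> j $ i + N ^ 3"
    using assms(2) by (auto simp: block_def Suc_le_eq)
  have "N ^ l * j $ i \<le> N ^ l * (b $ i div N ^ l + c $ i)" using 1(1) by (rule mult_le_mono2)
  also have "\<dots> \<le> b $ i + N ^ l * c $ i" by (simp add: distrib_left)
  finally show "N ^ l * j $ i \<le> b $ i + N ^ l * c $ i" .
  have "b $ i < N ^ l * (b $ i div N ^ l + 1)"
    using assms(1) by (metis add.commute dividend_less_times_div mult.commute mult_Suc plus_1_eq_Suc zero_less_power)
  then have "b $ i + N ^ l * c $ i < N ^ l * (b $ i div N ^ l + c $ i + 1)" by (simp add: distrib_left)
  also have "\<dots> \<le> N ^ l * (j $ i + N ^ 3)" using 1(2) by (rule mult_le_mono2)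
  finally show "b $ i + N ^ l * c $ i < N ^ l * j $ i + N ^ 3 * N ^ l" by (simp add: distrib_left mult.commute)
qed

lemma not_block_bounds:
  assumes "N > 0" "vec_div b (N ^ l) \<notin> block N 3 c j"
  shows "\<exists>i. b $ i + N ^ l * c $ i < N ^ l * j $ i \<or> N ^ l * j $ i + N ^ 3 * N ^ l \<le> b $ i + N ^ l * c $ i"
proof -
  obtain i where i: "b $ i div N ^ l + c $ i + 1 \<le> j $ i \<or> j $ i + N ^ 3 \<le> b $ i div N ^ l + c $ i"
    using assms(2) by (auto simp: block_def Suc_le_eq not_le not_less)
  have lt: "b $ i < N ^ l * (b $ i div N ^ l + 1)"
    using assms(1) by (metis add.commute dividend_less_times_div mult.commute mult_Suc plus_1_eq_Suc zero_less_power)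
  show ?thesis
  proof (intro exI[of _ i], cases "b $ i div N ^ l + c $ i + 1 \<le> j $ i")
    case True
    have "b $ i + N ^ l * c $ i < N ^ l * (b $ i div N ^ l + c $ i + 1)" using lt by (simp add: distrib_left)
    also have "\<dots> \<le> N ^ l * j $ i" using True by (rule mult_le_mono2)
    finally show "b $ i + N ^ l * c $ i < N ^ l * j $ i \<or> N ^ l * j $ i + N ^ 3 * N ^ l \<le> b $ i + N ^ l * c $ i" ..
  next
    case False
    then have "N ^ l * (j $ i + N ^ 3) \<le> N ^ l * (b $ i div N ^ l + c $ i)" using i by (intro mult_le_mono2) auto
    also have "\<dots> \<le> b $ i + N ^ l * c $ i" by (simp add: distrib_left)
    finally show "b $ i + N ^ l * c $ i < N ^ l * j $ i \<or> N ^ l * j $ i + N ^ 3 * N ^ l \<le> b $ i + N ^ l * c $ i"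
      by (simp add: distrib_left mult.commute)
  qed
qed

text \<open>The translation carries the window into the unit cube and \<open>j\<close> to its
  centre. Only one direction holds in general, because a window cut off at a coordinate hyperplane
  fills just part of the unit cube.\<close>

lemma escapes_translate_imp_spans:
  assumes "N \<ge> 2"
    "escapes N (\<lambda>(l, b). \<omega> (l - n + 3, translate N (centre N) j (l - n) b)) n k j"
  shows "spans N \<omega> k"
proof -
  have N: "N > 0" using assms by simp
  let ?w = "\<lambda>(l, b). \<omega> (l - n + 3, translate N (centre N) j (l - n) b)"
  let ?g = "translate N (centre N) j k"
  let ?S = "alive N ?w n k \<inter> {x. vec_div x (N ^ k) \<in> block N 3 (centre N) j}"
  let ?T = "alive N \<omega> 3 k \<inter> {x. vec_div x (N ^ k) \<in> {y. \<forall>i. y $ i < N ^ 3}}"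
  obtain a b c where abc: "vec_div a (N ^ k) = j" "linked ?S a b" "near 1 b c"
    "vec_div c (N ^ k) \<notin> block N 3 (centre N) j"
    using assms(2) unfolding escapes_def by blast
  have S_T: "?g x \<in> ?T" if x: "x \<in> ?S" for x
  proof -
    have "?g x \<in> alive N \<omega> 3 k" using x alive_translate[OF N] by blast
    moreover have "?g x $ i div N ^ k < N ^ 3" for i
    proof -
      have "?g x $ i < N ^ 3 * N ^ k"
        using block_coord_bounds[OF N, of x k "centre N" j i] x unfolding translate_nth by simp
      then show ?thesis using N by (simp add: div_less_iff_less_mult)
    qed
    ultimately show ?thesis by simp
  qed
  have 1: "linked ?T (?g a) (?g b)"
    by (rule linked_image[OF abc(2)], erule S_T, rule near_translate)
  have 2: "vec_div (?g a) (N ^ k) = centre N"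
    using translate_div[OF N, of "centre N" j k 0 a] abc(1) by (simp add: vec_eq_iff translate_nth)
  obtain i where i: "c $ i + N ^ k * centre N $ i < N ^ k * j $ i \<or>
      N ^ k * j $ i + N ^ 3 * N ^ k \<le> c $ i + N ^ k * centre N $ i"
    using not_block_bounds[OF N abc(4)] by blast
  have "vec_div b (N ^ k) \<in> block N 3 (centre N) j" using linked_mem[OF abc(2)] by simp
  note bb = block_coord_bounds[OF N this, of i]
  \<comment> \<open>The cube \<open>b\<close> is inside the window and its neighbour
    \<open>c\<close> is outside in direction \<open>i\<close>, so \<open>b\<close> lies in an
    extreme layer, which the translation sends to a face.\<close>
  have "b $ i \<le> c $ i + 1" "c $ i \<le> b $ i + 1" using abc(3) by (auto simp: near_def)
  then have "?g b $ i = 0 \<or> ?g b $ i = N ^ 3 * N ^ k - 1"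
    using i bb unfolding translate_nth by linarith
  then show ?thesis unfolding spans_def using 1 2 by blast
qed

text \<open>Relabelling coins by the translation preserves probability, since it is injective on the
  coins below the window, where no subtraction truncates. An upper bound is the direction that the
  recursion requires.\<close>

lemma prob_escapes_le:
  assumes "N \<ge> 2" "0 \<le> p" "p \<le> 1"
  shows "measure (coins p) {\<omega> :: nat \<times> (nat ^ 'n::finite) \<Rightarrow> bool. escapes N \<omega> n k j}
    \<le> span_prob TYPE('n) N p k"
proof -
  have N: "N > 0" using assms by simp
  let ?\<pi> = "\<lambda>(l, b). (l - n + 3, translate N (centre N) j (l - n) b)"
  let ?F = "descendants N n k (block N 3 (centre N) j)"
  have fin: "finite ?F" by (intro finite_descendants finite_block N)
  have inj: "inj_on ?\<pi> ?F"
  proof (rule inj_onI)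
    fix x y assume x: "x \<in> ?F" and y: "y \<in> ?F" and eq: "?\<pi> x = ?\<pi> y"
    obtain l b where lb: "x = (n + l, b)" "vec_div b (N ^ l) \<in> block N 3 (centre N) j"
      using x unfolding descendants_def by blast
    obtain l' b' where lb': "y = (n + l', b')" "vec_div b' (N ^ l') \<in> block N 3 (centre N) j"
      using y unfolding descendants_def by blast
    have l: "l = l'" using eq lb lb' by simp
    have "b $ i = b' $ i" for i
    proof -
      have "translate N (centre N) j l b $ i = translate N (centre N) j l b' $ i"
        using eq lb lb' l by simp
      then show ?thesis
        using block_coord_bounds(1)[OF N lb(2), of i] block_coord_bounds(1)[OF N lb'(2), of i] l
        unfolding translate_nth by simp
    qed
    then show "x = y" using lb lb' l by (simp add: vec_eq_iff)
  qed
  have comp: "\<omega> \<circ> ?\<pi> = (\<lambda>(l, b). \<omega> (l - n + 3, translate N (centre N) j (l - n) b))"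
    for \<omega> :: "nat \<times> (nat ^ 'n) \<Rightarrow> bool" by auto
  have "measure (coins p) {\<omega>. escapes N \<omega> n k j} = measure (coins p) {\<omega>. escapes N (\<omega> \<circ> ?\<pi>) n k j}"
    by (rule prob_reindex(1)[OF assms(2,3) fin inj determined_by_escapes, symmetric])
  also have "\<dots> \<le> span_prob TYPE('n) N p k"
    unfolding span_prob_def
    using escapes_translate_imp_spans[OF assms(1)] sets_spans[OF N assms(2,3)]
    by (intro coins.finite_measure_mono) (auto simp: comp)
  finally show ?thesis .
qed

text \<open>\<open>q\<close> and \<open>q'\<close> are the level-6 ancestors of the two ends of the
  crossing. In the direction of the face that is reached they are at least \<open>N ^ 3\<close>
  apart, which is the width of a window. Hence the windows are disjoint and each end lies outside
  the window of the other, so the chain, read forwards and backwards, escapes from both.\<close>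

lemma spans_imp_two_escapes:
  assumes "N \<ge> 2" "spans N \<omega> (3 + k)"
  shows "\<exists>q q'. (\<forall>i. q $ i < N ^ 6) \<and> (\<forall>i. q' $ i < N ^ 6) \<and>
    block N 3 (centre N) q \<inter> block N 3 (centre N) q' = {} \<and>
    escapes N \<omega> 6 k q \<and> escapes N \<omega> 6 k q'"
proof -
  have N: "N > 0" using assms by simp
  let ?S = "alive N \<omega> 3 (3 + k) \<inter> {x. vec_div x (N ^ (3 + k)) \<in> {y. \<forall>i. y $ i < N ^ 3}}"
  obtain a b i where ab: "vec_div a (N ^ (3 + k)) = centre N" "linked ?S a b"
    "b $ i = 0 \<or> b $ i = N ^ 3 * N ^ (3 + k) - 1"
    using assms(2) unfolding spans_def by blast
  define q where "q = vec_div a (N ^ k)"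
  define q' where "q' = vec_div b (N ^ k)"
  have bounds: "vec_div x (N ^ k) $ i < N ^ 6" if "x \<in> ?S" for x i
  proof -
    have "x $ i div N ^ (3 + k) < N ^ 3" using that by simp
    then have "(x $ i div N ^ k) div N ^ 3 < N ^ 3"
      by (simp add: power_add div_mult2_eq[symmetric] mult.commute)
    then have "x $ i div N ^ k < N ^ 3 * N ^ 3" using N by (simp add: div_less_iff_less_mult)
    then show ?thesis by (simp flip: power_add)
  qed
  have lnk: "linked (alive N \<omega> 6 k) a b"
    by (rule linked_mono[OF ab(2)]) (auto simp: alive_add)
  have "vec_div q (N ^ 3) = centre N"
    using ab(1) by (simp add: q_def vec_div_vec_div power_add mult.commute)
  then have "q $ i div N ^ 3 = centre N $ i" by (simp add: vec_eq_iff)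
  then have "centre N $ i * N ^ 3 \<le> q $ i" "q $ i < (centre N $ i + 1) * N ^ 3"
    using N by (simp_all add: div_less_iff_less_mult[symmetric] less_eq_div_iff_mult_less_eq[symmetric] del: mult_Suc add_mult_distrib)
  moreover have "1 * N ^ 3 \<le> centre N $ i * N ^ 3" "(centre N $ i + 2) * N ^ 3 \<le> N ^ 3 * N ^ 3"
    by (rule mult_le_mono1, rule centre_bounds[OF assms(1)])+
  \<comment> \<open>The margin on both sides of the central cube, in level-6 units. The second
    inequality is strict because the last layer has index \<open>N ^ 3 * N ^ 3 - 1\<close>.\<close>
  ultimately have q: "N ^ 3 \<le> q $ i" "q $ i + N ^ 3 < N ^ 3 * N ^ 3"
    unfolding distrib_right mult_2 mult_1 by linarith+
  have "q' $ i = 0 \<or> q' $ i = N ^ 3 * N ^ 3 - 1"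
  proof -
    have "(N ^ 3 * N ^ (3 + k) - 1) div N ^ k = N ^ 3 * N ^ 3 - 1"
    proof (rule div_nat_eqI)
      have eq: "N ^ 3 * N ^ (3 + k) = N ^ k * (N ^ 3 * N ^ 3)" by (simp add: power_add)
      have pos: "0 < N ^ k" "0 < N ^ 3 * N ^ 3" using N by auto
      then show "N ^ k * (N ^ 3 * N ^ 3 - 1) \<le> N ^ 3 * N ^ (3 + k) - 1"
        unfolding eq diff_mult_distrib2 by linarith
      show "N ^ 3 * N ^ (3 + k) - 1 < N ^ k * Suc (N ^ 3 * N ^ 3 - 1)"
        unfolding eq using pos by (simp del: power_mult_distrib)
    qed
    then show ?thesis using ab(3) by (auto simp: q'_def)
  qed
  then have far: "q' $ i + N ^ 3 \<le> q $ i \<or> q $ i + N ^ 3 \<le> q' $ i" using q by auto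
  have c: "centre N $ i < N ^ 3" using centre_bounds(2)[OF assms(1), of i] by linarith
  have "block N 3 (centre N) q \<inter> block N 3 (centre N) q' = {}"
  proof (rule equals0I)
    fix x assume "x \<in> block N 3 (centre N) q \<inter> block N 3 (centre N) q'"
    then have "q $ i \<le> x $ i + centre N $ i" "x $ i + centre N $ i < q $ i + N ^ 3"
      "q' $ i \<le> x $ i + centre N $ i" "x $ i + centre N $ i < q' $ i + N ^ 3"
      by (auto simp: block_def)
    then show False using far by linarith
  qed
  moreover have "q' \<notin> block N 3 (centre N) q" "q \<notin> block N 3 (centre N) q'"
  proof -
    show "q' \<notin> block N 3 (centre N) q"
    proof
      assume "q' \<in> block N 3 (centre N) q"
      then have "q $ i \<le> q' $ i + centre N $ i" "q' $ i + centre N $ i < q $ i + N ^ 3"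
        by (auto simp: block_def)
      then show False using far c by linarith
    qed
    show "q \<notin> block N 3 (centre N) q'"
    proof
      assume "q \<in> block N 3 (centre N) q'"
      then have "q' $ i \<le> q $ i + centre N $ i" "q $ i + centre N $ i < q' $ i + N ^ 3"
        by (auto simp: block_def)
      then show False using far c by linarith
    qed
  qed
  then have "escapes N \<omega> 6 k q" "escapes N \<omega> 6 k q'"
    using escapesI[OF assms(1) lnk] escapesI[OF assms(1) linked_sym[OF lnk]]
    by (auto simp: q_def q'_def)
  moreover have "\<forall>i. q $ i < N ^ 6" "\<forall>i. q' $ i < N ^ 6"
    using linked_mem[OF ab(2)] bounds unfolding q_def q'_def by blast+
  ultimately show ?thesis by blast
qed

text \<open>Union bound over ordered pairs of level-6 positions with disjoint windows; for each pair
  independence gives a product of two escape probabilities.\<close>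

lemma span_prob_recursion:
  assumes "N \<ge> 2" "0 \<le> p" "p \<le> 1"
  shows "span_prob TYPE('n::finite) N p (3 + k) \<le>
    (real (card {q :: nat ^ 'n. \<forall>i. q $ i < N ^ 6}))\<^sup>2 * (span_prob TYPE('n) N p k)\<^sup>2"
proof -
  have N: "N > 0" using assms by simp
  let ?Q = "{q :: nat ^ 'n. \<forall>i. q $ i < N ^ 6}"
  let ?u = "span_prob TYPE('n) N p k"
  let ?E = "\<lambda>(q, q'). {\<omega>. escapes N \<omega> 6 k q \<and> escapes N \<omega> 6 k q'}"
  let ?P = "{(q, q'). q \<in> ?Q \<and> q' \<in> ?Q \<and> block N 3 (centre N) q \<inter> block N 3 (centre N) q' = {}}"
  have sub: "?P \<subseteq> ?Q \<times> ?Q" by auto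
  have finP: "finite ?P" by (rule finite_subset[OF sub]) (intro finite_cartesian_product finite_vec_less)
  have E_sets: "?E z \<in> sets (coins p)" for z
  proof -
    obtain q q' where z: "z = (q, q')" by fastforce
    have "{\<omega>. escapes N \<omega> 6 k q \<and> escapes N \<omega> 6 k q'} =
      {\<omega>. escapes N \<omega> 6 k q} \<inter> {\<omega>. escapes N \<omega> 6 k q'}" by auto
    then show ?thesis unfolding z prod.case by (simp only: sets.Int sets_escapes[OF N assms(2,3)])
  qed
  have E_prob: "measure (coins p) (?E z) \<le> ?u * ?u" if "z \<in> ?P" for z
  proof -
    obtain q q' where z: "z = (q, q')" by fastforce
    then have disj: "block N 3 (centre N) q \<inter> block N 3 (centre N) q' = {}" using that by simp
    have "measure (coins p) (?E z) =
      measure (coins p) {\<omega>. escapes N \<omega> 6 k q} * measure (coins p) {\<omega>. escapes N \<omega> 6 k q'}"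
      unfolding z prod.case
      by (rule prob_indep[OF assms(2,3) _ _ descendants_disjoint[OF disj] determined_by_escapes determined_by_escapes])
        (intro finite_descendants finite_block N)+
    also have "\<dots> \<le> ?u * ?u"
      by (intro mult_mono prob_escapes_le assms) (auto simp: span_prob_def)
    finally show ?thesis .
  qed
  have "span_prob TYPE('n) N p (3 + k) \<le> measure (coins p) (\<Union>z\<in>?P. ?E z)"
    unfolding span_prob_def
  proof (rule coins.finite_measure_mono)
    show "{\<omega>. spans N \<omega> (3 + k)} \<subseteq> (\<Union>z\<in>?P. ?E z)"
    proof
      fix \<omega> :: "nat \<times> (nat ^ 'n) \<Rightarrow> bool" assume "\<omega> \<in> {\<omega>. spans N \<omega> (3 + k)}"
      then obtain q q' where q: "\<forall>i. q $ i < N ^ 6" "\<forall>i. q' $ i < N ^ 6"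
        "block N 3 (centre N) q \<inter> block N 3 (centre N) q' = {}" "escapes N \<omega> 6 k q" "escapes N \<omega> 6 k q'"
        using spans_imp_two_escapes[OF assms(1)] by blast
      show "\<omega> \<in> (\<Union>z\<in>?P. ?E z)" by (rule UN_I[of "(q, q')"]) (use q in simp_all)
    qed
    show "(\<Union>z\<in>?P. ?E z) \<in> sets (coins p)" using E_sets finP by (intro sets.finite_UN)
  qed
  also have "\<dots> \<le> (\<Sum>z\<in>?P. measure (coins p) (?E z))"
    by (rule coins.finite_measure_subadditive_finite[OF finP]) (use E_sets in blast)
  also have "\<dots> \<le> (\<Sum>z\<in>?P. ?u * ?u)" using E_prob by (rule sum_mono)
  also have "\<dots> = real (card ?P) * (?u * ?u)" by simp
  also have "\<dots> \<le> real (card (?Q \<times> ?Q)) * (?u * ?u)"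
    by (intro mult_right_mono of_nat_mono card_mono sub finite_cartesian_product finite_vec_less) simp
  also have "\<dots> = (real (card ?Q))\<^sup>2 * ?u\<^sup>2"
    by (simp add: card_cartesian_product power2_eq_square)
  finally show ?thesis .
qed

section \<open>Consequences for the limit set\<close>

text \<open>In the normalised quantity \<open>D * u\<close> the recursion is plain squaring, so a
  value below 1 at one depth decays along every third depth.\<close>

lemma span_prob_tendsto_0:
  assumes "N \<ge> 2" "0 \<le> p" "p \<le> 1" "e > 0"
    and small: "(real (card {q :: nat ^ 'n::finite. \<forall>i. q $ i < N ^ 6}))\<^sup>2 * span_prob TYPE('n) N p k < 1"
  shows "\<exists>l. span_prob TYPE('n) N p l < e"
proof -
  define D where "D = (real (card {q :: nat ^ 'n. \<forall>i. q $ i < N ^ 6}))\<^sup>2"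
  let ?u = "span_prob TYPE('n) N p"
  have u: "0 \<le> ?u l" for l by (simp add: span_prob_def)
  have "(0 :: nat ^ 'n) \<in> {q. \<forall>i. q $ i < N ^ 6}" using assms(1) by simp
  then have "{q :: nat ^ 'n. \<forall>i. q $ i < N ^ 6} \<noteq> {}" by blast
  then have "card {q :: nat ^ 'n. \<forall>i. q $ i < N ^ 6} > 0"
    by (intro card_gt_0_iff[THEN iffD2] conjI finite_vec_less)
  then have "1 \<le> real (card {q :: nat ^ 'n. \<forall>i. q $ i < N ^ 6})" by linarith
  then have D: "D \<ge> 1" unfolding D_def by (rule one_le_power)
  let ?r = "D * ?u k"
  have r: "0 \<le> ?r" "?r < 1" using u[of k] D small by (simp_all add: D_def)
  have bound: "D * ?u (k + 3 * i) \<le> ?r ^ Suc i" for i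
  proof (induction i)
    case (Suc i)
    have "?u (3 + (k + 3 * i)) \<le> D * (?u (k + 3 * i))\<^sup>2"
      unfolding D_def by (rule span_prob_recursion[OF assms(1-3)])
    then have "D * ?u (k + 3 * Suc i) \<le> D * (D * (?u (k + 3 * i))\<^sup>2)"
      using D by (intro mult_left_mono) (simp_all add: add.commute add.left_commute)
    also have "\<dots> = (D * ?u (k + 3 * i)) * (D * ?u (k + 3 * i))"
      by (simp add: power2_eq_square)
    also have "\<dots> \<le> ?r ^ Suc i * ?r ^ Suc i"
      using Suc.IH D u r by (intro mult_mono) simp_all
    \<comment> \<open>The squared bound is weakened to one extra factor \<open>?r\<close>; geometric
      decay is enough.\<close>
    also have "\<dots> \<le> ?r ^ Suc i * ?r"
      using r power_decreasing[of 1 "Suc i" ?r] by (intro mult_left_mono) simp_all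
    finally show ?case by (simp add: mult.commute)
  qed simp
  have "(\<lambda>i. ?r ^ i) \<longlonglongrightarrow> 0" using r by (intro LIMSEQ_realpow_zero)
  from order_tendstoD(2)[OF this assms(4)] obtain i where "\<forall>n\<ge>i. ?r ^ n < e"
    unfolding eventually_sequentially by blast
  then have i: "?r ^ Suc i < e" using le_SucI[OF le_refl] by blast
  have "1 * ?u (k + 3 * i) \<le> D * ?u (k + 3 * i)" using D u by (intro mult_right_mono)
  then show ?thesis using bound[of i] i by (intro exI[of _ "k + 3 * i"]) linarith
qed

text \<open>At a fine enough level \<open>n\<close> the ancestors of cubes around \<open>x\<close>
  and \<open>y\<close> are too far apart to share a window, so the chain joining them escapes. This
  \<open>n\<close> depends on the two points but not on the further depth \<open>k\<close>.\<close>

lemma connected_limit_set_imp_escapes: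
  fixes \<omega> :: "nat \<times> (nat ^ 'n::finite) \<Rightarrow> bool"
  assumes "N \<ge> 2" "connected_component (limit_set N \<omega>) x y" "x \<noteq> y"
  shows "\<exists>n. \<forall>k. \<exists>j. (\<forall>i. j $ i < N ^ n) \<and> escapes N \<omega> n k j"
proof -
  have N: "N > 0" using assms by simp
  obtain i where i: "x $ i \<noteq> y $ i" using assms(3) by (auto simp: vec_eq_iff)
  have "1 < real N" using assms(1) by simp
  \<comment> \<open>Level-\<open>n\<close> cubes in a common window differ by at most
    \<open>N ^ 3\<close> in each coordinate, and the extent of the cubes themselves adds 1.\<close>
  then obtain n where n: "(real (N ^ 3) + 1) / \<bar>x $ i - y $ i\<bar> < real N ^ n"
    using real_arch_pow by blast
  then have n: "real (N ^ 3) + 1 < \<bar>x $ i - y $ i\<bar> * real (N ^ n)"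
    using i by (simp add: divide_less_eq mult.commute)
  obtain C where C: "connected C" "C \<subseteq> limit_set N \<omega>" "x \<in> C" "y \<in> C"
    using assms(2) unfolding connected_component_def by auto
  show ?thesis
  proof (intro exI[of _ n] allI)
    fix k
    have "limit_set N \<omega> \<subseteq> retained_set N \<omega> (n + k)" unfolding limit_set_eq[OF N] by (rule INF_lower) simp
    with C(2) have "C \<subseteq> (\<Union>j\<in>retained_cubes N \<omega> (n + k). subcube N (n + k) j)"
      unfolding retained_set_def by (rule order_trans)
    from connected_imp_linked[OF N finite_retained_cubes[OF N] C(1) this C(3,4)]
    obtain a b where ab: "x \<in> subcube N (n + k) a" "y \<in> subcube N (n + k) b"
      "linked (retained_cubes N \<omega> (n + k)) a b"
      by blast
    let ?a = "vec_div a (N ^ k)" and ?b = "vec_div b (N ^ k)"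
    have lnk: "linked (alive N \<omega> n k) a b"
      by (rule linked_mono[OF ab(3)]) (auto simp: retained_cubes_alive alive_add)
    have "x \<in> subcube N n ?a" "y \<in> subcube N n ?b"
      using ab(1,2) subcube_subset_parent[OF N] by auto
    then have xy: "real (?a $ i) / real (N ^ n) \<le> x $ i" "x $ i \<le> (real (?a $ i) + 1) / real (N ^ n)"
      "real (?b $ i) / real (N ^ n) \<le> y $ i" "y $ i \<le> (real (?b $ i) + 1) / real (N ^ n)"
      unfolding mem_subcube by simp_all
    have pos: "real (N ^ n) > 0" using N by simp
    have "?b \<notin> block N 3 (centre N) ?a"
    proof
      assume "?b \<in> block N 3 (centre N) ?a"
      then have "?a $ i \<le> ?b $ i + centre N $ i" "?b $ i + centre N $ i < ?a $ i + N ^ 3"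
        unfolding block_def by blast+
      moreover have "centre N $ i \<le> N ^ 3" using centre_bounds(2)[OF assms(1), of i] by linarith
      ultimately have "?a $ i \<le> ?b $ i + N ^ 3" "?b $ i \<le> ?a $ i + N ^ 3" by linarith+
      then have "real (?a $ i) \<le> real (?b $ i) + real (N ^ 3)" "real (?b $ i) \<le> real (?a $ i) + real (N ^ 3)"
        by linarith+
      moreover have "real (?a $ i) \<le> x $ i * real (N ^ n)" "x $ i * real (N ^ n) \<le> real (?a $ i) + 1"
        "real (?b $ i) \<le> y $ i * real (N ^ n)" "y $ i * real (N ^ n) \<le> real (?b $ i) + 1"
        using xy pos by (simp_all only: pos_divide_le_eq pos_le_divide_eq)
      ultimately have "\<bar>x $ i * real (N ^ n) - y $ i * real (N ^ n)\<bar> \<le> real (N ^ 3) + 1" by linarith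
      then have "\<bar>x $ i - y $ i\<bar> * real (N ^ n) \<le> real (N ^ 3) + 1"
        using pos by (simp only: left_diff_distrib[symmetric] abs_mult abs_of_pos)
      then show False using n by linarith
    qed
    then have "escapes N \<omega> n k ?a" by (rule escapesI[OF assms(1) lnk])
    moreover have "?a $ l < N ^ n" for l
    proof -
      have "a $ l < N ^ n * N ^ k"
        using retained_cubes_less[OF N, of a \<omega> "n + k" l] linked_mem[OF ab(3)] by (simp add: power_add)
      then show ?thesis using N by (simp add: div_less_iff_less_mult)
    qed
    ultimately show "\<exists>j. (\<forall>i. j $ i < N ^ n) \<and> escapes N \<omega> n k j" by blast
  qed
qed

text \<open>For fixed \<open>n\<close> there are finitely many starting cubes, so escaping at all
  depths from one of them has probability 0; a countable union over \<open>n\<close> follows. The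
  exceptional set is only enclosed in a null set, which avoids showing that total disconnectedness
  is measurable.\<close>

lemma AE_totally_disconnected:
  assumes "N \<ge> 2" "0 \<le> p" "p \<le> 1"
    and small: "(real (card {q :: nat ^ 'n::finite. \<forall>i. q $ i < N ^ 6}))\<^sup>2 * span_prob TYPE('n) N p k < 1"
  shows "AE \<omega> in coins p. totally_disconnected (limit_set N \<omega> :: (real ^ 'n) set)"
proof -
  have N: "N > 0" using assms by simp
  let ?Q = "\<lambda>n. {j :: nat ^ 'n. \<forall>i. j $ i < N ^ n}"
  let ?E = "\<lambda>n k. \<Union>j\<in>?Q n. {\<omega>. escapes N \<omega> n k j}"
  have sets: "?E n k \<in> sets (coins p)" for n k
    using sets_escapes[OF N assms(2,3)] finite_vec_less by (intro sets.finite_UN) auto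
  have prob: "measure (coins p) (?E n k) \<le> real (card (?Q n)) * span_prob TYPE('n) N p k" for n k
  proof -
    have "measure (coins p) (?E n k) \<le> (\<Sum>j\<in>?Q n. measure (coins p) {\<omega>. escapes N \<omega> n k j})"
      using sets_escapes[OF N assms(2,3)] finite_vec_less
      by (intro coins.finite_measure_subadditive_finite) auto
    also have "\<dots> \<le> (\<Sum>j\<in>?Q n. span_prob TYPE('n) N p k)"
      by (intro sum_mono prob_escapes_le assms)
    finally show ?thesis by simp
  qed
  have inter: "(\<Inter>k. ?E n k) \<in> sets (coins p)" for n using sets by (intro sets.countable_INT) blast+
  have null: "(\<Inter>k. ?E n k) \<in> null_sets (coins p)" for n
  proof -
    have "measure (coins p) (\<Inter>k. ?E n k) \<le> e" if "e > 0" for e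
    proof -
      have "e / (real (card (?Q n)) + 1) > 0" using that by (intro divide_pos_pos) auto
      from span_prob_tendsto_0[OF assms(1-3) this small]
      obtain l where l: "span_prob TYPE('n) N p l < e / (real (card (?Q n)) + 1)" by blast
      have "measure (coins p) (\<Inter>k. ?E n k) \<le> measure (coins p) (?E n l)"
        using sets by (intro coins.finite_measure_mono) auto
      also have "\<dots> \<le> real (card (?Q n)) * span_prob TYPE('n) N p l" by (rule prob)
      also have "\<dots> \<le> (real (card (?Q n)) + 1) * (e / (real (card (?Q n)) + 1))"
        using l by (intro mult_mono) (auto simp: span_prob_def)
      also have "\<dots> = e" by simp
      finally show ?thesis .
    qed
    then have "measure (coins p) (\<Inter>k. ?E n k) \<le> 0" by (rule field_le_epsilon) simp
    then have "measure (coins p) (\<Inter>k. ?E n k) = 0" using measure_le_0_iff by blast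
    then show ?thesis using inter by (auto simp: null_sets_def coins.emeasure_eq_measure)
  qed
  have "(\<Union>n. \<Inter>k. ?E n k) \<in> null_sets (coins p)" using null by (intro null_sets_UN)
  moreover have "{\<omega> \<in> space (coins p). \<not> totally_disconnected (limit_set N \<omega> :: (real ^ 'n) set)} \<subseteq>
    (\<Union>n. \<Inter>k. ?E n k)"
  proof
    fix \<omega> :: "nat \<times> (nat ^ 'n) \<Rightarrow> bool"
    assume "\<omega> \<in> {\<omega> \<in> space (coins p). \<not> totally_disconnected (limit_set N \<omega> :: (real ^ 'n) set)}"
    then obtain x y where "connected_component (limit_set N \<omega>) x y" "x \<noteq> y"
      unfolding totally_disconnected_iff by blast
    from connected_limit_set_imp_escapes[OF assms(1) this]
    obtain n where n: "\<And>k. \<exists>j. (\<forall>i. j $ i < N ^ n) \<and> escapes N \<omega> n k j" by blast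
    have "\<omega> \<in> ?E n k" for k using n[of k] by simp
    then show "\<omega> \<in> (\<Union>n. \<Inter>k. ?E n k)" by (intro UN_I[of n] INT_I) simp_all
  qed
  ultimately show ?thesis by (rule AE_I')
qed

lemma determined_by_crosses_annulus:
  "determined_by (descendants N 0 k {0}) (\<lambda>\<omega>. crosses_annulus (retained_set N \<omega> k))"
  unfolding determined_by_def
proof (intro allI impI)
  fix \<omega> \<omega>' :: "nat \<times> (nat ^ 'a) \<Rightarrow> bool"
  assume "\<forall>i\<in>descendants N 0 k {0}. \<omega> i = \<omega>' i"
  from alive_Int_cong[OF this]
  have "retained_cubes N \<omega> k = retained_cubes N \<omega>' k" unfolding retained_cubes_alive by auto
  then show "crosses_annulus (retained_set N \<omega> k) = crosses_annulus (retained_set N \<omega>' k)"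
    by (simp add: retained_set_def)
qed

lemma sets_crosses_annulus:
  assumes "N > 0" "0 \<le> p" "p \<le> 1"
  shows "{\<omega> :: nat \<times> (nat ^ 'n::finite) \<Rightarrow> bool. crosses_annulus (retained_set N \<omega> k)} \<in> sets (coins p)"
    and "{\<omega> :: nat \<times> (nat ^ 'n) \<Rightarrow> bool. crosses_annulus (limit_set N \<omega>)} \<in> sets (coins p)"
proof -
  show *: "{\<omega> :: nat \<times> (nat ^ 'n) \<Rightarrow> bool. crosses_annulus (retained_set N \<omega> k)} \<in> sets (coins p)" for k
    by (rule sets_determined[OF assms(2,3) _ determined_by_crosses_annulus])
      (intro finite_descendants assms finite.intros)
  have "{\<omega> :: nat \<times> (nat ^ 'n) \<Rightarrow> bool. crosses_annulus (limit_set N \<omega>)} =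
    (\<Inter>k. {\<omega>. crosses_annulus (retained_set N \<omega> k)})"
    using crosses_annulus_limit_set[OF assms(1)] by auto
  moreover have "(\<Inter>k. {\<omega> :: nat \<times> (nat ^ 'n) \<Rightarrow> bool. crosses_annulus (retained_set N \<omega> k)}) \<in> sets (coins p)"
    using * by (intro sets.countable_INT) blast+
  ultimately show "{\<omega> :: nat \<times> (nat ^ 'n) \<Rightarrow> bool. crosses_annulus (limit_set N \<omega>)} \<in> sets (coins p)"
    by simp
qed

text \<open>If levels 1 to 3 survive entirely, cubes alive from level 3 on are genuinely retained.
  The chain then joins a point of the middle cube to a point of the outer boundary and has to pass
  the frontier of the middle cube.\<close>

lemma spans_imp_crosses_annulus:
  fixes \<omega> :: "nat \<times> (nat ^ 'n::finite) \<Rightarrow> bool"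
  assumes "N \<ge> 2" "\<forall>i\<in>descendants N 0 3 {0}. \<omega> i" "spans N \<omega> k"
  shows "crosses_annulus (retained_set N \<omega> (3 + k))"
proof -
  have N: "N > 0" using assms by simp
  let ?S = "alive N \<omega> 3 k \<inter> {x. vec_div x (N ^ k) \<in> {y. \<forall>i. y $ i < N ^ 3}}"
  let ?K = "N ^ (3 + k)"
  obtain a b i where ab: "vec_div a (N ^ k) = centre N" "linked ?S a b"
    "b $ i = 0 \<or> b $ i = N ^ 3 * N ^ k - 1"
    using assms(3) unfolding spans_def by blast
  have alive_True: "alive N (\<lambda>_. True) n l = (UNIV :: (nat ^ 'n) set)" for n l by (induction l) auto
  have top: "x \<in> alive N \<omega> 0 3" if "vec_div x (N ^ 3) = 0" for x
    using alive_cong[of N 0 3 "{0}" \<omega> "\<lambda>_. True" x] that assms(2) alive_True by auto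
  have "?S \<subseteq> retained_cubes N \<omega> (3 + k)"
  proof
    fix x assume x: "x \<in> ?S"
    then have *: "vec_div (vec_div x (N ^ k)) (N ^ 3) = 0" by (simp add: vec_eq_iff)
    then have "vec_div x ?K = 0" by (simp add: vec_div_vec_div power_add mult.commute)
    moreover have "x \<in> alive N \<omega> 0 (3 + k)" using x top[OF *] by (simp add: alive_add)
    ultimately show "x \<in> retained_cubes N \<omega> (3 + k)" by (simp add: retained_cubes_alive)
  qed
  then have lnk: "linked (retained_cubes N \<omega> (3 + k)) a b" by (rule linked_mono[OF ab(2)])
  obtain x where x: "x \<in> subcube N (3 + k) a" using subcube_nonempty[OF N] by blast
  have "x \<in> subcube N 3 (centre N)" using x subcube_subset_parent[OF N, of 3 k a] ab(1) by auto
  then have x_bd: "real (centre N $ l) / real (N ^ 3) \<le> x $ l" "x $ l \<le> (real (centre N $ l) + 1) / real (N ^ 3)" for l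
    unfolding mem_subcube by simp_all
  have x_in: "x \<in> cbox (\<chi> i. 1 / 3) (\<chi> i. 2 / 3)"
    unfolding mem_box_cart
  proof (intro allI conjI)
    fix l :: 'n
    have pos: "real (N ^ 3) > 0" using N by simp
    have "real (N ^ 3) \<le> real (3 * centre N $ l)" "real (3 * (centre N $ l + 1)) \<le> real (2 * N ^ 3)"
      by (rule of_nat_mono, rule centre_bounds[OF assms(1)])+
    then have "real (N ^ 3) \<le> 3 * real (centre N $ l)" "3 * (real (centre N $ l) + 1) \<le> 2 * real (N ^ 3)"
      by (simp_all only: of_nat_mult of_nat_add of_nat_numeral of_nat_1)
    moreover have "K \<le> 3 * a \<Longrightarrow> 1 / 3 \<le> a / K" "3 * a \<le> 2 * K \<Longrightarrow> a / K \<le> 2 / 3" if "K > 0" for a K :: real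
      using that by (simp_all add: field_simps)
    ultimately have third: "1 / 3 \<le> real (centre N $ l) / real (N ^ 3)" "(real (centre N $ l) + 1) / real (N ^ 3) \<le> 2 / 3"
      using pos by blast+
    show "(\<chi> i. 1 / 3) $ l \<le> x $ l" "x $ l \<le> (\<chi> i. 2 / 3) $ l"
      unfolding vec_lambda_beta using order_trans[OF third(1) x_bd(1)] order_trans[OF x_bd(2) third(2)] by blast+
  qed
  have b_less: "b $ l < ?K" for l
    using linked_mem[OF lnk] retained_cubes_less[OF N] by blast
  have pos: "real ?K > 0" using N by simp
  \<comment> \<open>The lower corner of cube \<open>b\<close> if it touches the face at 0, the upper
    corner otherwise, so that coordinate \<open>i\<close> is exactly 0 or 1.\<close>
  define y :: "real ^ 'n" where "y = (\<chi> l. (real (b $ l) + (if b $ i = 0 then 0 else 1)) / real ?K)"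
  have y_in: "y \<in> subcube N (3 + k) b"
    unfolding mem_subcube y_def using pos by (auto intro!: divide_right_mono)
  have y01: "0 \<le> y $ l \<and> y $ l \<le> 1" for l
  proof -
    have "real (b $ l) + 1 \<le> real ?K" using b_less[of l] by linarith
    moreover have "real (b $ l) \<le> real ?K" using b_less[of l] by simp
    ultimately show ?thesis using pos unfolding y_def vec_lambda_beta by simp
  qed
  have yi: "y $ i = 0 \<or> y $ i = 1"
  proof (cases "b $ i = 0")
    case False
    then have "b $ i + 1 = ?K" using ab(3) N by (simp add: power_add)
    then have "real (b $ i) + 1 = real ?K" by linarith
    then show ?thesis using False pos by (simp add: y_def)
  qed (simp add: y_def)
  have "y \<in> cbox (\<chi> i. 0) (\<chi> i. 1)" using y01 by (simp add: mem_box_cart)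
  moreover have "y \<notin> box (\<chi> i. 0) (\<chi> i. 1)" using yi by (auto simp: mem_box_cart intro!: exI[of _ i])
  ultimately have y_out: "y \<in> outer_boundary"
    by (simp add: outer_boundary_def frontier_cbox)
  have y_notin: "y \<notin> cbox (\<chi> i. 1 / 3) (\<chi> i. 2 / 3)"
    unfolding mem_box_cart using yi by (auto intro!: exI[of _ i])
  have "connected_component (retained_set N \<omega> (3 + k)) x y"
    unfolding retained_set_def by (rule linked_imp_connected_component[OF N lnk x y_in])
  then obtain C where C: "connected C" "C \<subseteq> retained_set N \<omega> (3 + k)" "x \<in> C" "y \<in> C"
    unfolding connected_component_def by auto
  have "C \<inter> frontier (cbox (\<chi> i. 1 / 3) (\<chi> i. 2 / 3)) \<noteq> {}"
    by (rule connected_Int_frontier[OF C(1)]) (use C x_in y_notin in blast)+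
  then obtain z where "z \<in> C" "z \<in> inner_boundary" by (auto simp: inner_boundary_def)
  moreover from this have "connected_component (retained_set N \<omega> (3 + k)) z y"
    using C unfolding connected_component_def by auto
  ultimately show ?thesis
    unfolding crosses_annulus_def connected_component_iff_components[symmetric] using y_out by blast
qed

text \<open>Survival of levels 1 to 3 is independent of \<open>spans\<close>, which uses deeper
  coins only. The product of the two probabilities is a lower bound uniform in the depth and passes
  to the decreasing limit.\<close>

lemma crossing_prob_pos:
  assumes "N \<ge> 2" "0 < p" "p \<le> 1" "c > 0" "\<And>k. c \<le> span_prob TYPE('n::finite) N p k"
  shows "crossing_prob TYPE('n) N p > 0"
proof -
  have N: "N > 0" and p: "0 \<le> p" using assms by simp_all
  let ?X = "\<lambda>k. {\<omega> :: nat \<times> (nat ^ 'n) \<Rightarrow> bool. crosses_annulus (retained_set N \<omega> k)}"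
  let ?H = "descendants N 0 3 {0 :: nat ^ 'n}"
  let ?G = "\<lambda>k. descendants N 3 k {y :: nat ^ 'n. \<forall>i. y $ i < N ^ 3}"
  let ?h = "p ^ card ?H"
  have sub: "?X m \<subseteq> ?X l" if "l \<le> m" for l m
    using crosses_annulus_antimono[OF retained_set_antimono[OF N that]] by auto
  have lower: "?h * c \<le> measure (coins p) (?X k)" for k
  proof -
    have H: "measure (coins p) {\<omega>. \<forall>i\<in>?H. \<omega> i} = ?h"
      by (intro prob_all_retained finite_descendants p N assms(3) finite.intros)
    have "?h * c \<le> measure (coins p) {\<omega>. \<forall>i\<in>?H. \<omega> i} *
        measure (coins p) {\<omega> :: nat \<times> (nat ^ 'n) \<Rightarrow> bool. spans N \<omega> k}"
      unfolding H using assms(5)[of k] p unfolding span_prob_def by (intro mult_left_mono) simp_all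
    also have "\<dots> = measure (coins p) {\<omega>. (\<forall>i\<in>?H. \<omega> i) \<and> spans N \<omega> k}"
    proof (rule prob_indep[symmetric, OF p assms(3), of ?H "?G k"])
      show "?H \<inter> ?G k = {}" by (auto simp: descendants_def)
      show "determined_by ?H (\<lambda>\<omega>. \<forall>i\<in>?H. \<omega> i)" unfolding determined_by_def by simp
    qed (intro finite_descendants N finite.intros finite_vec_less determined_by_spans)+
    also have "\<dots> \<le> measure (coins p) (?X (3 + k))"
      using sets_crosses_annulus[OF N p assms(3)] spans_imp_crosses_annulus[OF assms(1)]
      by (intro coins.finite_measure_mono) auto
    also have "\<dots> \<le> measure (coins p) (?X k)"
      using sets_crosses_annulus[OF N p assms(3)] sub[of k "3 + k"] by (intro coins.finite_measure_mono) auto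
    finally show ?thesis .
  qed
  have "(\<lambda>k. measure (coins p) (?X k)) \<longlonglongrightarrow> measure (coins p) (\<Inter>k. ?X k)"
    using sets_crosses_annulus[OF N p assms(3)] sub
    by (intro coins.finite_Lim_measure_decseq) (auto simp: decseq_def)
  then have "?h * c \<le> measure (coins p) (\<Inter>k. ?X k)"
    using lower by (intro LIMSEQ_le_const) auto
  also have "(\<Inter>k. ?X k) = {\<omega>. crosses_annulus (limit_set N \<omega>)}"
    using crosses_annulus_limit_set[OF N] by auto
  finally have "?h * c \<le> crossing_prob TYPE('n) N p" by (simp add: crossing_prob_def)
  moreover have "0 < ?h * c" using assms by simp
  ultimately show ?thesis by linarith
qed

text \<open>The two boundaries of the annulus are disjoint, so a crossing component has at least two
  points.\<close>

lemma crossing_prob_pos_imp_not_AE: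
  assumes "N \<ge> 2" "0 \<le> p" "p \<le> 1" "crossing_prob TYPE('n::finite) N p > 0"
  shows "\<not> (AE \<omega> in coins p. totally_disconnected (limit_set N \<omega> :: (real ^ 'n) set))"
proof
  have N: "N > 0" using assms by simp
  assume "AE \<omega> in coins p. totally_disconnected (limit_set N \<omega> :: (real ^ 'n) set)"
  note AE = this
  have not_crosses: "\<not> crosses_annulus S" if td: "totally_disconnected S" for S :: "(real ^ 'n) set"
  proof
    assume "crosses_annulus S"
    then obtain x y where xy: "x \<in> inner_boundary" "y \<in> outer_boundary" "connected_component S x y"
      unfolding crosses_annulus_def connected_component_iff_components[symmetric] by blast
    have eq: "x = y" using td xy(3) unfolding totally_disconnected_iff by simp
    have "x \<in> cbox (\<chi> i. 1 / 3) (\<chi> i. 2 / 3)"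
      using xy(1) by (simp add: inner_boundary_def frontier_cbox)
    then have *: "1 / 3 \<le> x $ i \<and> x $ i \<le> 2 / 3" for i unfolding mem_box_cart vec_lambda_beta by blast
    have "0 < x $ i \<and> x $ i < 1" for i using *[of i] by linarith
    then have "x \<in> box (\<chi> i. 0) (\<chi> i. 1)" unfolding mem_box_cart vec_lambda_beta by blast
    moreover have "y \<notin> box (\<chi> i. 0) (\<chi> i. 1)" using xy(2) by (simp add: outer_boundary_def frontier_cbox)
    ultimately show False using eq by simp
  qed
  have "AE \<omega> in coins p. \<not> crosses_annulus (limit_set N \<omega> :: (real ^ 'n) set)"
    using AE by (rule eventually_mono) (rule not_crosses)
  then have "measure (coins p) {\<omega>. crosses_annulus (limit_set N \<omega> :: (real ^ 'n) set)} = 0"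
    using coins.prob_eq_0[OF sets_crosses_annulus(2)[where 'n = 'n, OF N assms(2,3)]] by simp
  then show False using assms(4) by (simp add: crossing_prob_def)
qed

section \<open>Connectivity for retention probability near one\<close>

lemma connected_chain_UN:
  fixes f :: "nat \<Rightarrow> 'a::topological_space set"
  assumes "\<And>s. s < m \<Longrightarrow> connected (f s)" "\<And>s. s < m \<Longrightarrow> f s \<noteq> {}"
    "\<And>s. Suc s < m \<Longrightarrow> connected (f s \<union> f (Suc s))"
  shows "connected (\<Union>s<m. f s)"
  using assms
proof (induction m)
  case (Suc m)
  show ?case
  proof (cases m)
    case 0
    then show ?thesis using Suc.prems(1)[of 0] by (simp add: lessThan_Suc)
  next
    case (Suc m')
    have 1: "connected (\<Union>s<m. f s)"
      by (rule Suc.IH) (use Suc.prems in \<open>simp_all\<close>)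
    have 2: "connected (f m' \<union> f m)" using Suc.prems(3)[of m'] Suc by simp
    have 3: "f m' \<noteq> {}" using Suc.prems(2)[of m'] Suc by simp
    have sub: "f m' \<subseteq> (\<Union>s<m. f s)" using Suc by auto
    have "connected ((\<Union>s<m. f s) \<union> (f m' \<union> f m))"
      by (rule connected_Un[OF 1 2]) (use sub 3 in blast)
    moreover have "(\<Union>s<m. f s) \<union> (f m' \<union> f m) = (\<Union>s<Suc m. f s)"
      using sub by (auto simp: lessThan_Suc)
    ultimately show ?thesis by simp
  qed
qed simp

text \<open>Every cell of a grid with one cell removed lies in a complete row or a complete column, and
  each complete row meets each complete column.\<close>

lemma connected_punctured_grid:
  fixes S :: "nat \<Rightarrow> nat \<Rightarrow> 'a::topological_space set"
  assumes "m \<ge> 2"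
    and conn: "\<And>s t. s < m \<Longrightarrow> t < m \<Longrightarrow> (s, t) \<noteq> (u, v) \<Longrightarrow> connected (S s t)"
    and ne: "\<And>s t. s < m \<Longrightarrow> t < m \<Longrightarrow> (s, t) \<noteq> (u, v) \<Longrightarrow> S s t \<noteq> {}"
    and row: "\<And>s t. Suc s < m \<Longrightarrow> t < m \<Longrightarrow> (s, t) \<noteq> (u, v) \<Longrightarrow> (Suc s, t) \<noteq> (u, v) \<Longrightarrow>
      connected (S s t \<union> S (Suc s) t)"
    and col: "\<And>s t. s < m \<Longrightarrow> Suc t < m \<Longrightarrow> (s, t) \<noteq> (u, v) \<Longrightarrow> (s, Suc t) \<noteq> (u, v) \<Longrightarrow>
      connected (S s t \<union> S s (Suc t))"
  shows "connected (\<Union>(s, t)\<in>{..<m} \<times> {..<m} - {(u, v)}. S s t)"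
proof -
  let ?R = "\<lambda>t. \<Union>s<m. S s t" and ?C = "\<lambda>s. \<Union>t<m. S s t"
  obtain s0 where s0: "s0 < m" "s0 \<noteq> u" using assms(1) by (cases "u = 0") (auto intro: that[of 0] that[of 1])
  obtain t0 where t0: "t0 < m" "t0 \<noteq> v" using assms(1) by (cases "v = 0") (auto intro: that[of 0] that[of 1])
  have R: "connected (?R t)" if "t < m" "t \<noteq> v" for t
    by (rule connected_chain_UN) (use that conn ne row in auto)
  have C: "connected (?C s)" if "s < m" "s \<noteq> u" for s
    by (rule connected_chain_UN) (use that conn ne col in auto)
  have RC: "connected (?R t \<union> ?C s)" if "s < m" "s \<noteq> u" "t < m" "t \<noteq> v" for s t
  proof (rule connected_Un[OF R C])
    have "S s t \<subseteq> ?R t \<inter> ?C s" using that by auto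
    then show "?R t \<inter> ?C s \<noteq> {}" using ne[of s t] that by auto
  qed (use that in auto)
  \<comment> \<open>Row \<open>t0\<close> and column \<open>s0\<close> are fixed complete lines.
    Every \<open>?X z\<close> is connected and contains the cell \<open>(s0, t0)\<close>, so the
    union over all \<open>z\<close> is connected.\<close>
  let ?X = "\<lambda>(s, t). (?R t0 \<union> ?C s) \<union> (?R t \<union> ?C s0)"
  let ?I = "({..<m} - {u}) \<times> ({..<m} - {v})"
  have X: "connected (?X z)" if "z \<in> ?I" for z
  proof -
    obtain s t where z1: "z = (s, t)" by fastforce
    then have z: "s < m" "s \<noteq> u" "t < m" "t \<noteq> v" using that by simp_all
    have "S s0 t0 \<subseteq> (?R t0 \<union> ?C s) \<inter> (?R t \<union> ?C s0)" using s0 t0 by auto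
    then have "(?R t0 \<union> ?C s) \<inter> (?R t \<union> ?C s0) \<noteq> {}" using ne[of s0 t0] s0 t0 by auto
    then show ?thesis unfolding z1 prod.case using z s0 t0 by (intro connected_Un RC)
  qed
  have "connected (\<Union>(?X ` ?I))"
  proof (rule connected_Union)
    have "S s0 t0 \<subseteq> \<Inter>(?X ` ?I)" using s0 t0 by auto
    then show "\<Inter>(?X ` ?I) \<noteq> {}" using ne[of s0 t0] s0 t0 by auto
  qed (use X in auto)
  moreover have "\<Union>(?X ` ?I) = (\<Union>(s, t)\<in>{..<m} \<times> {..<m} - {(u, v)}. S s t)" (is "?lhs = ?rhs")
  proof (intro equalityI subsetI)
    fix x assume "x \<in> ?lhs"
    then obtain z where z: "z \<in> ?I" "x \<in> ?X z" by (rule UN_E)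
    obtain s t where zst: "z = (s, t)" by fastforce
    have st: "s < m" "s \<noteq> u" "t < m" "t \<noteq> v" using z(1) zst by simp_all
    have rhsI: "x \<in> ?rhs" if "s' < m" "t' < m" "s' \<noteq> u \<or> t' \<noteq> v" "x \<in> S s' t'" for s' t'
      by (rule UN_I[of "(s', t')"]) (use that in simp_all)
    have "x \<in> ?R t0 \<or> x \<in> ?C s \<or> x \<in> ?R t \<or> x \<in> ?C s0" using z(2) unfolding zst prod.case by blast
    then consider s' where "s' < m" "x \<in> S s' t0" | t' where "t' < m" "x \<in> S s t'"
      | s' where "s' < m" "x \<in> S s' t" | t' where "t' < m" "x \<in> S s0 t'"
      by blast
    then show "x \<in> ?rhs" by cases (rule rhsI; use s0 t0 st in simp)+
  next
    fix x assume "x \<in> ?rhs"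
    then obtain z where z: "z \<in> {..<m} \<times> {..<m} - {(u, v)}" "x \<in> (case z of (s, t) \<Rightarrow> S s t)" by (rule UN_E)
    obtain s t where zst: "z = (s, t)" by fastforce
    have st: "s < m" "t < m" "s \<noteq> u \<or> t \<noteq> v" "x \<in> S s t" using z unfolding zst by simp_all
    have C: "x \<in> ?C s" using st(2,4) by blast
    have R: "x \<in> ?R t" using st(1,4) by blast
    show "x \<in> ?lhs"
    proof (cases "t = v")
      case True
      then have "(s, t0) \<in> ?I" using st t0 by simp
      moreover have "x \<in> ?X (s, t0)" using C by simp
      ultimately show ?thesis by (rule UN_I)
    next
      case False
      then have "(s0, t) \<in> ?I" using st s0 by simp
      moreover have "x \<in> ?X (s0, t)" using R by simp
      ultimately show ?thesis by (rule UN_I)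
    qed
  qed
  ultimately show ?thesis by simp
qed

text \<open>The two-dimensional slice with all other coordinates 0, which is closed under passing to
  ancestors.\<close>

definition plane_address :: "'n \<Rightarrow> 'n \<Rightarrow> nat \<Rightarrow> nat \<Rightarrow> nat ^ 'n" where
  "plane_address i j x y = (\<chi> l. if l = i then x else if l = j then y else 0)"

lemma vec_div_plane_address:
  "vec_div (plane_address i j x y) m = plane_address i j (x div m) (y div m)"
  by (simp add: plane_address_def vec_eq_iff)

lemma plane_address_eq_iff:
  "i \<noteq> j \<Longrightarrow> plane_address i j x y = plane_address i j x' y' \<longleftrightarrow> x = x' \<and> y = y'"
  by (auto simp: plane_address_def vec_eq_iff)

lemma div_cell: "s < m \<Longrightarrow> (m * x + s) div m = (x :: nat)"
  by (simp add: div_mult_self4)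

context
  fixes N :: nat and i j :: "'n::finite"
  assumes N: "N \<ge> 2" and ij: "i \<noteq> j"
begin

abbreviation adr :: "nat \<Rightarrow> nat \<Rightarrow> nat ^ 'n" where
  "adr \<equiv> plane_address i j"

text \<open>Each step covers two levels. Survival of all \<open>N ^ 2\<close> children ensures that
  the coins of grandchildren count, and the single permitted bad grandchild makes failure quadratic.
  The position \<open>(u, v)\<close> is unrestricted, so it may also lie outside the grid.\<close>

primrec good :: "(nat \<times> (nat ^ 'n) \<Rightarrow> bool) \<Rightarrow> nat \<Rightarrow> nat \<Rightarrow> nat \<Rightarrow> nat \<Rightarrow> bool" where
  "good \<omega> 0 l x y \<longleftrightarrow> True"
| "good \<omega> (Suc k) l x y \<longleftrightarrow>
     (\<forall>s<N. \<forall>t<N. \<omega> (l + 1, adr (N * x + s) (N * y + t))) \<and>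
     (\<exists>u v. \<forall>s<N\<^sup>2. \<forall>t<N\<^sup>2. (s, t) \<noteq> (u, v) \<longrightarrow>
        \<omega> (l + 2, adr (N\<^sup>2 * x + s) (N\<^sup>2 * y + t)) \<and> good \<omega> k (l + 2) (N\<^sup>2 * x + s) (N\<^sup>2 * y + t))"

definition good_cells :: "(nat \<times> (nat ^ 'n) \<Rightarrow> bool) \<Rightarrow> nat \<Rightarrow> nat \<Rightarrow> nat \<Rightarrow> nat \<Rightarrow> (nat \<times> nat) set" where
  "good_cells \<omega> k l x y = {(s, t). s < N\<^sup>2 \<and> t < N\<^sup>2 \<and>
     \<omega> (l, adr (N\<^sup>2 * x + s) (N\<^sup>2 * y + t)) \<and> good \<omega> k l (N\<^sup>2 * x + s) (N\<^sup>2 * y + t)}"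

text \<open>What remains at level \<open>l + 2 * k\<close> after following good cells only. It may
  be smaller than the retained part of the square, but its connectivity can be proved by
  recursion.\<close>

primrec cluster :: "(nat \<times> (nat ^ 'n) \<Rightarrow> bool) \<Rightarrow> nat \<Rightarrow> nat \<Rightarrow> nat \<Rightarrow> nat \<Rightarrow> (real ^ 'n) set" where
  "cluster \<omega> 0 l x y = subcube N l (adr x y)"
| "cluster \<omega> (Suc k) l x y =
     (\<Union>(s, t)\<in>good_cells \<omega> k (l + 2) x y. cluster \<omega> k (l + 2) (N\<^sup>2 * x + s) (N\<^sup>2 * y + t))"

lemma N2: "N\<^sup>2 \<ge> 4"
  using power_mono[of 2 N 2] N by simp

lemma good_cells_punctured:
  assumes "good \<omega> (Suc k) l x y"
  obtains u v where "good_cells \<omega> k (l + 2) x y = {..<N\<^sup>2} \<times> {..<N\<^sup>2} - {(u, v)}"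
proof -
  obtain u v where uv: "\<forall>s<N\<^sup>2. \<forall>t<N\<^sup>2. (s, t) \<noteq> (u, v) \<longrightarrow>
        \<omega> (l + 2, adr (N\<^sup>2 * x + s) (N\<^sup>2 * y + t)) \<and> good \<omega> k (l + 2) (N\<^sup>2 * x + s) (N\<^sup>2 * y + t)"
    using assms unfolding good.simps by blast
  then have sup: "{..<N\<^sup>2} \<times> {..<N\<^sup>2} - {(u, v)} \<subseteq> good_cells \<omega> k (l + 2) x y"
    unfolding good_cells_def by auto
  have sub: "good_cells \<omega> k (l + 2) x y \<subseteq> {..<N\<^sup>2} \<times> {..<N\<^sup>2}" unfolding good_cells_def by auto
  show thesis
  proof (cases "(u, v) \<in> good_cells \<omega> k (l + 2) x y")
    case True
    \<comment> \<open>No cell is missing here, so the puncture is put at a position outside the grid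
      to keep a single form.\<close>
    then have "good_cells \<omega> k (l + 2) x y = {..<N\<^sup>2} \<times> {..<N\<^sup>2} - {(N\<^sup>2, 0)}"
      using sub sup by auto
    then show ?thesis by (rule that)
  next
    case False
    then have "good_cells \<omega> k (l + 2) x y = {..<N\<^sup>2} \<times> {..<N\<^sup>2} - {(u, v)}"
      using sub sup by auto
    then show ?thesis by (rule that)
  qed
qed

lemma cluster_subset: "cluster \<omega> k l x y \<subseteq> subcube N l (adr x y)"
proof (induction k arbitrary: l x y)
  case (Suc k)
  show ?case unfolding cluster.simps
  proof (rule UN_least)
    fix z assume "z \<in> good_cells \<omega> k (l + 2) x y"
    then obtain s t where z: "z = (s, t)" "s < N\<^sup>2" "t < N\<^sup>2" by (auto simp: good_cells_def)
    have "subcube N (l + 2) (adr (N\<^sup>2 * x + s) (N\<^sup>2 * y + t)) \<subseteq> subcube N l (adr x y)"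
      using subcube_subset_parent[of N l 2 "adr (N\<^sup>2 * x + s) (N\<^sup>2 * y + t)"] N z
      by (simp only: vec_div_plane_address div_cell)
    then show "(case z of (s, t) \<Rightarrow> cluster \<omega> k (l + 2) (N\<^sup>2 * x + s) (N\<^sup>2 * y + t)) \<subseteq> subcube N l (adr x y)"
      using Suc.IH[of "l + 2" "N\<^sup>2 * x + s" "N\<^sup>2 * y + t"] z(1) by simp
  qed
qed simp

lemma cluster_retained:
  assumes "good \<omega> k l x y" "adr x y \<in> retained_cubes N \<omega> l"
  shows "cluster \<omega> k l x y \<subseteq> retained_set N \<omega> (l + 2 * k)"
  using assms
proof (induction k arbitrary: l x y)
  case 0
  then show ?case by (auto simp: retained_set_def)
next
  case (Suc k)
  show ?case unfolding cluster.simps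
  proof (rule UN_least)
    fix z assume "z \<in> good_cells \<omega> k (l + 2) x y"
    then obtain s t where z: "z = (s, t)" "s < N\<^sup>2" "t < N\<^sup>2"
      "\<omega> (l + 2, adr (N\<^sup>2 * x + s) (N\<^sup>2 * y + t))" "good \<omega> k (l + 2) (N\<^sup>2 * x + s) (N\<^sup>2 * y + t)"
      by (auto simp: good_cells_def)
    have lt: "s div N < N" "t div N < N"
      using z(2,3) N by (simp_all add: div_less_iff_less_mult power2_eq_square)
    have dv: "(N\<^sup>2 * x + s) div N = N * x + s div N" for x s
      using N by (simp add: power2_eq_square mult.assoc)
    have "\<omega> (l + 1, adr (N * x + s div N) (N * y + t div N))"
      using Suc.prems(1) lt unfolding good.simps by blast
    moreover have "vec_div (adr (N * x + s div N) (N * y + t div N)) N = adr x y"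
      using lt by (simp only: vec_div_plane_address div_cell)
    ultimately have "adr (N * x + s div N) (N * y + t div N) \<in> retained_cubes N \<omega> (Suc l)"
      using Suc.prems(2) by (simp flip: vec_div_def)
    then have "adr (N\<^sup>2 * x + s) (N\<^sup>2 * y + t) \<in> retained_cubes N \<omega> (Suc (Suc l))"
      using z(4) by (simp add: vec_div_plane_address dv flip: vec_div_def)
    then have "cluster \<omega> k (l + 2) (N\<^sup>2 * x + s) (N\<^sup>2 * y + t) \<subseteq> retained_set N \<omega> (l + 2 + 2 * k)"
      by (intro Suc.IH z(5)) simp
    then show "(case z of (s, t) \<Rightarrow> cluster \<omega> k (l + 2) (N\<^sup>2 * x + s) (N\<^sup>2 * y + t)) \<subseteq>
      retained_set N \<omega> (l + 2 * Suc k)"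
      using z(1) by simp
  qed
qed

text \<open>Two adjacent punctured grids share a line that avoids both holes: three candidates
  suffice, and \<open>N ^ 2\<close> is at least 4.\<close>

lemma exists_common_index: "\<exists>t<N\<^sup>2. t \<noteq> v \<and> t \<noteq> v'"
proof -
  have "\<exists>t\<in>{0, 1, 2 :: nat}. t \<noteq> v \<and> t \<noteq> v'"
    by (cases "v = 0"; cases "v' = 0"; cases "v = 1"; cases "v' = 1") auto
  then obtain t where t: "t \<in> {0, 1, 2 :: nat}" "t \<noteq> v" "t \<noteq> v'" by blast
  then have "t \<le> 2" by auto
  then have "t < N\<^sup>2" using N2 by linarith
  then show ?thesis using t(2,3) by blast
qed

text \<open>Connectedness alone is not inductive. Adjacent cells must be joined as well, so the
  statement also covers unions with good right and upper neighbours; these follow by gluing along a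
  row or column that is intact in both squares.\<close>

lemma cluster_connected:
  "good \<omega> k l x y \<longrightarrow> cluster \<omega> k l x y \<noteq> {} \<and> connected (cluster \<omega> k l x y) \<and>
     (good \<omega> k l (Suc x) y \<longrightarrow> connected (cluster \<omega> k l x y \<union> cluster \<omega> k l (Suc x) y)) \<and>
     (good \<omega> k l x (Suc y) \<longrightarrow> connected (cluster \<omega> k l x y \<union> cluster \<omega> k l x (Suc y)))"
proof (induction k arbitrary: l x y)
  case 0
  have N0: "N > 0" using N by simp
  have "near 1 (adr x y) (adr (Suc x) y)" "near 1 (adr x y) (adr x (Suc y))"
    by (auto simp: near_def plane_address_def)
  from this[THEN near_imp_subcubes_meet[OF N0]]
  show ?case
    by (simp add: subcube_nonempty[OF N0] connected_subcube connected_Un)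
next
  case (Suc k)
  have IH_ne: "cluster \<omega> k l x y \<noteq> {}" and IH_conn: "connected (cluster \<omega> k l x y)"
    if "good \<omega> k l x y" for l x y
    using Suc.IH[of l x y] that by simp_all
  have IH_right: "connected (cluster \<omega> k l x y \<union> cluster \<omega> k l (Suc x) y)"
    if "good \<omega> k l x y" "good \<omega> k l (Suc x) y" for l x y
    using Suc.IH[of l x y] that by simp
  have IH_up: "connected (cluster \<omega> k l x y \<union> cluster \<omega> k l x (Suc y))"
    if "good \<omega> k l x y" "good \<omega> k l x (Suc y)" for l x y
    using Suc.IH[of l x y] that by simp
  let ?c = "\<lambda>x y s t. cluster \<omega> k (l + 2) (N\<^sup>2 * x + s) (N\<^sup>2 * y + t)"
  have cell: "good \<omega> k (l + 2) (N\<^sup>2 * x + s) (N\<^sup>2 * y + t)" if "(s, t) \<in> good_cells \<omega> k (l + 2) x y" for s t x y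
    using that by (simp add: good_cells_def)
  have one: "cluster \<omega> (Suc k) l x y \<noteq> {} \<and> connected (cluster \<omega> (Suc k) l x y)" if g: "good \<omega> (Suc k) l x y" for x y
  proof -
    obtain u v where uv: "good_cells \<omega> k (l + 2) x y = {..<N\<^sup>2} \<times> {..<N\<^sup>2} - {(u, v)}"
      by (rule good_cells_punctured[OF g])
    have gc: "good \<omega> k (l + 2) (N\<^sup>2 * x + s) (N\<^sup>2 * y + t)" if "s < N\<^sup>2" "t < N\<^sup>2" "(s, t) \<noteq> (u, v)" for s t
      by (rule cell) (use that uv in auto)
    have "connected (cluster \<omega> (Suc k) l x y)"
      unfolding cluster.simps uv
    proof (rule connected_punctured_grid)
      show "2 \<le> N\<^sup>2" using N2 by simp
      show "connected (?c x y s t)" "?c x y s t \<noteq> {}" if "s < N\<^sup>2" "t < N\<^sup>2" "(s, t) \<noteq> (u, v)" for s t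
        by (rule IH_conn[OF gc[OF that]], rule IH_ne[OF gc[OF that]])
      show "connected (?c x y s t \<union> ?c x y (Suc s) t)"
        if "Suc s < N\<^sup>2" "t < N\<^sup>2" "(s, t) \<noteq> (u, v)" "(Suc s, t) \<noteq> (u, v)" for s t
        using IH_right[of "l + 2" "N\<^sup>2 * x + s" "N\<^sup>2 * y + t"] gc[of s t] gc[of "Suc s" t] that by simp
      show "connected (?c x y s t \<union> ?c x y s (Suc t))"
        if "s < N\<^sup>2" "Suc t < N\<^sup>2" "(s, t) \<noteq> (u, v)" "(s, Suc t) \<noteq> (u, v)" for s t
        using IH_up[of "l + 2" "N\<^sup>2 * x + s" "N\<^sup>2 * y + t"] gc[of s t] gc[of s "Suc t"] that by simp
    qed
    moreover have "cluster \<omega> (Suc k) l x y \<noteq> {}"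
    proof -
      obtain t where t: "t < N\<^sup>2" "t \<noteq> v" using exists_common_index by blast
      moreover have "0 < N\<^sup>2" using N2 by linarith
      ultimately have mem: "(0, t) \<in> good_cells \<omega> k (l + 2) x y" unfolding uv by simp
      have "?c x y 0 t \<noteq> {}" by (rule IH_ne[OF cell[OF mem]])
      then obtain z where "z \<in> ?c x y 0 t" by blast
      then have "z \<in> cluster \<omega> (Suc k) l x y" unfolding cluster.simps by (intro UN_I[OF mem]) simp
      then show ?thesis by blast
    qed
    ultimately show ?thesis by blast
  qed
  \<comment> \<open>One connected pair of finer clusters glues the larger ones: attach the pair to
    the first cluster, then attach the second.\<close>
  have join: "connected (cluster \<omega> (Suc k) l x y \<union> cluster \<omega> (Suc k) l x' y')"
    if g: "good \<omega> (Suc k) l x y" "good \<omega> (Suc k) l x' y'"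
      and mem: "(s, t) \<in> good_cells \<omega> k (l + 2) x y" "(s', t') \<in> good_cells \<omega> k (l + 2) x' y'"
      and conn: "connected (?c x y s t \<union> ?c x' y' s' t')" for x y x' y' s t s' t'
  proof -
    let ?A = "cluster \<omega> (Suc k) l x y" and ?B = "cluster \<omega> (Suc k) l x' y'"
    have sub: "?c x y s t \<subseteq> ?A" "?c x' y' s' t' \<subseteq> ?B"
      unfolding cluster.simps by (rule subsetI, rule UN_I, rule mem, simp)+
    obtain z z' where z: "z \<in> ?c x y s t" "z' \<in> ?c x' y' s' t'"
      using IH_ne[OF cell[OF mem(1)]] IH_ne[OF cell[OF mem(2)]] by (meson ex_in_conv)
    have "z \<in> ?A \<inter> (?c x y s t \<union> ?c x' y' s' t')" using z(1) subsetD[OF sub(1) z(1)] by simp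
    then have 1: "connected (?A \<union> (?c x y s t \<union> ?c x' y' s' t'))"
      by (intro connected_Un conn conjunct2[OF one[OF g(1)]]) (simp only: ex_in_conv[symmetric], rule exI)
    have "z' \<in> (?A \<union> (?c x y s t \<union> ?c x' y' s' t')) \<inter> ?B" using z(2) subsetD[OF sub(2) z(2)] by simp
    then have joined: "connected ((?A \<union> (?c x y s t \<union> ?c x' y' s' t')) \<union> ?B)"
      by (intro connected_Un 1 conjunct2[OF one[OF g(2)]]) (simp only: ex_in_conv[symmetric], rule exI)
    have absorb: "(A \<union> (P \<union> Q)) \<union> B = A \<union> B" if "P \<subseteq> A" "Q \<subseteq> B" for A B P Q :: "(real ^ 'n) set"
      using that by blast
    show ?thesis using joined unfolding absorb[OF sub] .
  qed
  show ?case
  proof (intro impI conjI)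
    assume g: "good \<omega> (Suc k) l x y"
    obtain u v where uv: "good_cells \<omega> k (l + 2) x y = {..<N\<^sup>2} \<times> {..<N\<^sup>2} - {(u, v)}"
      by (rule good_cells_punctured[OF g])
    show "cluster \<omega> (Suc k) l x y \<noteq> {}" "connected (cluster \<omega> (Suc k) l x y)"
      by (rule conjunct1[OF one[OF g]], rule conjunct2[OF one[OF g]])
    have last: "Suc (N\<^sup>2 * x + (N\<^sup>2 - 1)) = N\<^sup>2 * Suc x" for x using N2 by simp
    have lt: "N\<^sup>2 - 1 < N\<^sup>2" "0 < N\<^sup>2" using N2 by linarith+
    show "connected (cluster \<omega> (Suc k) l x y \<union> cluster \<omega> (Suc k) l (Suc x) y)" if g': "good \<omega> (Suc k) l (Suc x) y"
    proof -
      obtain u' v' where uv': "good_cells \<omega> k (l + 2) (Suc x) y = {..<N\<^sup>2} \<times> {..<N\<^sup>2} - {(u', v')}"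
        by (rule good_cells_punctured[OF g'])
      obtain t where t: "t < N\<^sup>2" "t \<noteq> v" "t \<noteq> v'" using exists_common_index by blast
      have mem: "(N\<^sup>2 - 1, t) \<in> good_cells \<omega> k (l + 2) x y" "(0, t) \<in> good_cells \<omega> k (l + 2) (Suc x) y"
        unfolding uv uv' using t lt by simp_all
      have "connected (?c x y (N\<^sup>2 - 1) t \<union> ?c (Suc x) y 0 t)"
        using IH_right[of "l + 2" "N\<^sup>2 * x + (N\<^sup>2 - 1)" "N\<^sup>2 * y + t"] cell[OF mem(1)] cell[OF mem(2)]
        unfolding last[of x] add_0_right by blast
      then show ?thesis by (rule join[OF g g' mem])
    qed
    show "connected (cluster \<omega> (Suc k) l x y \<union> cluster \<omega> (Suc k) l x (Suc y))" if g': "good \<omega> (Suc k) l x (Suc y)"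
    proof -
      obtain u' v' where uv': "good_cells \<omega> k (l + 2) x (Suc y) = {..<N\<^sup>2} \<times> {..<N\<^sup>2} - {(u', v')}"
        by (rule good_cells_punctured[OF g'])
      obtain s where s: "s < N\<^sup>2" "s \<noteq> u" "s \<noteq> u'" using exists_common_index by blast
      have mem: "(s, N\<^sup>2 - 1) \<in> good_cells \<omega> k (l + 2) x y" "(s, 0) \<in> good_cells \<omega> k (l + 2) x (Suc y)"
        unfolding uv uv' using s lt by simp_all
      have "connected (?c x y s (N\<^sup>2 - 1) \<union> ?c x (Suc y) s 0)"
        using IH_up[of "l + 2" "N\<^sup>2 * x + s" "N\<^sup>2 * y + (N\<^sup>2 - 1)"] cell[OF mem(1)] cell[OF mem(2)]
        unfolding last[of y] add_0_right by blast
      then show ?thesis by (rule join[OF g g' mem])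
    qed
  qed
qed

lemma
  assumes "good \<omega> k l x y"
  shows cluster_nonempty: "cluster \<omega> k l x y \<noteq> {}"
    and connected_cluster: "connected (cluster \<omega> k l x y)"
  using cluster_connected[of \<omega> k l x y] assms by simp_all

text \<open>At each depth the cluster is connected and, along an intact row, reaches both the first
  and the last column of cells. The strips \<open>A\<close> and \<open>B\<close> are disjoint, so
  the connection that survives in the limit has distinct end points.\<close>

lemma good_imp_not_totally_disconnected:
  assumes "\<And>k. good \<omega> k 0 0 0"
  shows "\<not> totally_disconnected (limit_set N \<omega>)"
proof -
  have N0: "N > 0" using N by simp
  define A where "A = {x :: real ^ 'n. x $ i \<le> 1 / real (N\<^sup>2)}"
  define B where "B = {x :: real ^ 'n. (real (N\<^sup>2) - 1) / real (N\<^sup>2) \<le> x $ i}"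
  have "\<exists>a\<in>A. \<exists>b\<in>B. connected_component (limit_set N \<omega>) a b"
  proof (rule limit_set_connection[OF N0])
    show "closed A" "closed B" unfolding A_def B_def
      by (rule closed_halfspace_component_le_cart closed_halfspace_component_ge_cart)+
    fix k
    have g: "good \<omega> (Suc k) 0 0 0" by (rule assms)
    obtain u v where uv: "good_cells \<omega> k 2 0 0 = {..<N\<^sup>2} \<times> {..<N\<^sup>2} - {(u, v)}"
      by (rule good_cells_punctured[OF g, unfolded add_0])
    obtain t where t: "t < N\<^sup>2" "t \<noteq> v" using exists_common_index by blast
    have pick: "\<exists>z\<in>cluster \<omega> (Suc k) 0 0 0. z \<in> subcube N 2 (adr s t)" if "s < N\<^sup>2" for s
    proof -
      have mem: "(s, t) \<in> good_cells \<omega> k 2 0 0" unfolding uv using t that by simp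
      then have "good \<omega> k 2 s t" by (simp add: good_cells_def)
      then have "cluster \<omega> k 2 s t \<noteq> {}" by (rule cluster_nonempty)
      then obtain z where z: "z \<in> cluster \<omega> k 2 s t" by blast
      then have "z \<in> cluster \<omega> (Suc k) 0 0 0" unfolding cluster.simps add_0 by (intro UN_I[OF mem]) simp
      then show ?thesis using subsetD[OF cluster_subset z] by blast
    qed
    have lt: "0 < N\<^sup>2" "N\<^sup>2 - 1 < N\<^sup>2" using N2 by linarith+
    obtain a where a: "a \<in> cluster \<omega> (Suc k) 0 0 0" "a \<in> subcube N 2 (adr 0 t)" using pick[OF lt(1)] by blast
    obtain b where b: "b \<in> cluster \<omega> (Suc k) 0 0 0" "b \<in> subcube N 2 (adr (N\<^sup>2 - 1) t)" using pick[OF lt(2)] by blast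
    have "a $ i \<le> (real (adr 0 t $ i) + 1) / real (N\<^sup>2)" using a(2) unfolding mem_subcube by blast
    then have aA: "a \<in> A" by (simp add: A_def plane_address_def)
    have bB: "b \<in> B"
    proof -
      have "real (adr (N\<^sup>2 - 1) t $ i) / real (N\<^sup>2) \<le> b $ i" using b(2) unfolding mem_subcube by blast
      moreover have "real (adr (N\<^sup>2 - 1) t $ i) = real (N\<^sup>2) - 1"
        using N2 by (simp add: plane_address_def of_nat_diff)
      ultimately show ?thesis unfolding B_def by simp
    qed
    have "adr 0 0 \<in> retained_cubes N \<omega> 0" by (simp add: plane_address_def vec_eq_iff)
    then have "cluster \<omega> (Suc k) 0 0 0 \<subseteq> retained_set N \<omega> (0 + 2 * Suc k)" by (rule cluster_retained[OF g])
    then have conn: "connected_component (retained_set N \<omega> (2 * Suc k)) a b"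
      unfolding connected_component_def add_0 using connected_cluster[OF g] a(1) b(1)
      by (intro exI[of _ "cluster \<omega> (Suc k) 0 0 0"] conjI)
    have ge: "2 * Suc k \<ge> k" by simp
    show "\<exists>m\<ge>k. \<exists>a\<in>A. \<exists>b\<in>B. connected_component (retained_set N \<omega> m) a b"
      by (rule exI, rule conjI[OF ge], rule bexI[OF _ aA], rule bexI[OF _ bB], rule conn)
  qed
  then obtain a b where ab: "a \<in> A" "b \<in> B" "connected_component (limit_set N \<omega>) a b" by blast
  have "real (N\<^sup>2) \<ge> 4" using N2 by linarith
  then have "1 / real (N\<^sup>2) < (real (N\<^sup>2) - 1) / real (N\<^sup>2)" by (intro divide_strict_right_mono) linarith+
  moreover have "a $ i \<le> 1 / real (N\<^sup>2)" "(real (N\<^sup>2) - 1) / real (N\<^sup>2) \<le> b $ i"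
    using ab(1,2) unfolding A_def B_def by blast+
  ultimately have "a $ i < b $ i" by linarith
  then have "a \<noteq> b" by auto
  then show ?thesis using ab(3) unfolding totally_disconnected_iff by blast
qed

section \<open>Probability of good squares\<close>

lemma good_cong:
  assumes "\<forall>z\<in>descendants N l (2 * k) {adr x y}. \<omega> z = \<omega>' z"
  shows "good \<omega> k l x y = good \<omega>' k l x y"
  using assms
proof (induction k arbitrary: l x y)
  case (Suc k)
  have child: "\<omega> (l + 1, adr (N * x + s) (N * y + t)) = \<omega>' (l + 1, adr (N * x + s) (N * y + t))"
    if "s < N" "t < N" for s t
    by (intro Suc.prems[rule_format] descendantsI) (use that in \<open>simp_all add: vec_div_plane_address div_cell\<close>)
  have dv: "vec_div (adr (N\<^sup>2 * x + s) (N\<^sup>2 * y + t)) (N ^ 2) = adr x y"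
    if "s < N\<^sup>2" "t < N\<^sup>2" for s t
    using that by (simp only: vec_div_plane_address div_cell)
  have cell: "\<omega> (l + 2, adr (N\<^sup>2 * x + s) (N\<^sup>2 * y + t)) = \<omega>' (l + 2, adr (N\<^sup>2 * x + s) (N\<^sup>2 * y + t))"
    if "s < N\<^sup>2" "t < N\<^sup>2" for s t
    by (rule Suc.prems[rule_format], rule descendantsI) (use dv[OF that] in simp_all)
  have IH: "good \<omega> k (l + 2) (N\<^sup>2 * x + s) (N\<^sup>2 * y + t) = good \<omega>' k (l + 2) (N\<^sup>2 * x + s) (N\<^sup>2 * y + t)"
    if "s < N\<^sup>2" "t < N\<^sup>2" for s t
  proof (rule Suc.IH, rule ballI)
    fix z assume "z \<in> descendants N (l + 2) (2 * k) {adr (N\<^sup>2 * x + s) (N\<^sup>2 * y + t)}"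
    from subsetD[OF descendants_trans[OF dv[OF that]] this]
    have "z \<in> descendants N l (2 * Suc k) {adr x y}" by simp
    then show "\<omega> z = \<omega>' z" using Suc.prems by blast
  qed
  show ?case
    unfolding good.simps(2)
    by (intro arg_cong2[where f = "(\<and>)"] all_cong ex_cong1 imp_cong refl) (simp_all only: child cell IH)
qed simp

lemma determined_by_good:
  "determined_by (descendants N l (2 * k) {adr x y}) (\<lambda>\<omega>. good \<omega> k l x y)"
  unfolding determined_by_def using good_cong by blast

text \<open>Goodness decreases with depth, so being good at every depth is a decreasing limit of
  events.\<close>

lemma good_Suc_imp_good: "good \<omega> (Suc k) l x y \<Longrightarrow> good \<omega> k l x y"
proof (induction k arbitrary: l x y)
  case (Suc k)
  have child: "\<forall>s<N. \<forall>t<N. \<omega> (l + 1, adr (N * x + s) (N * y + t))"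
    using Suc.prems unfolding good.simps(2)[of _ "Suc k"] by blast
  obtain u v where uv: "\<forall>s<N\<^sup>2. \<forall>t<N\<^sup>2. (s, t) \<noteq> (u, v) \<longrightarrow>
        \<omega> (l + 2, adr (N\<^sup>2 * x + s) (N\<^sup>2 * y + t)) \<and>
        good \<omega> (Suc k) (l + 2) (N\<^sup>2 * x + s) (N\<^sup>2 * y + t)"
    using Suc.prems unfolding good.simps(2)[of _ "Suc k"] by blast
  show ?case
    unfolding good.simps(2)[of _ k]
  proof (intro conjI exI allI impI)
    fix s t assume "s < N" "t < N"
    then show "\<omega> (l + 1, adr (N * x + s) (N * y + t))" using child by blast
  next
    fix s t assume st: "s < N\<^sup>2" "t < N\<^sup>2" "(s, t) \<noteq> (u, v)"
    show "\<omega> (l + 2, adr (N\<^sup>2 * x + s) (N\<^sup>2 * y + t))" using uv st by blast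
    show "good \<omega> k (l + 2) (N\<^sup>2 * x + s) (N\<^sup>2 * y + t)" by (rule Suc.IH) (use uv st in blast)
  qed
qed simp

lemma not_good_Suc:
  assumes "\<not> good \<omega> (Suc k) l x y"
  defines "fails \<equiv> \<lambda>(s, t). \<not> (\<omega> (l + 2, adr (N\<^sup>2 * x + s) (N\<^sup>2 * y + t)) \<and>
    good \<omega> k (l + 2) (N\<^sup>2 * x + s) (N\<^sup>2 * y + t))"
  shows "(\<exists>s<N. \<exists>t<N. \<not> \<omega> (l + 1, adr (N * x + s) (N * y + t))) \<or>
    (\<exists>a\<in>{..<N\<^sup>2} \<times> {..<N\<^sup>2}. \<exists>b\<in>{..<N\<^sup>2} \<times> {..<N\<^sup>2}. a \<noteq> b \<and> fails a \<and> fails b)"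
proof (rule ccontr)
  let ?Q = "{..<N\<^sup>2} \<times> {..<N\<^sup>2}"
  assume neg: "\<not> ?thesis"
  have child: "\<omega> (l + 1, adr (N * x + s) (N * y + t))" if "s < N" "t < N" for s t
  proof (rule ccontr)
    assume "\<not> \<omega> (l + 1, adr (N * x + s) (N * y + t))"
    then have "\<exists>s<N. \<exists>t<N. \<not> \<omega> (l + 1, adr (N * x + s) (N * y + t))"
      using that by (intro exI[of _ s] exI[of _ t] conjI)
    then show False by (rule notE[OF neg disjI1])
  qed
  have two: "a = b" if "a \<in> ?Q" "b \<in> ?Q" "fails a" "fails b" for a b
  proof (rule ccontr)
    assume "a \<noteq> b"
    then have "\<exists>a\<in>?Q. \<exists>b\<in>?Q. a \<noteq> b \<and> fails a \<and> fails b"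
      using that by (intro bexI[of _ a] bexI[of _ b] conjI)
    then show False by (rule notE[OF neg disjI2])
  qed
  have "\<exists>c. \<forall>a\<in>?Q. a \<noteq> c \<longrightarrow> \<not> fails a"
  proof (cases "\<exists>c\<in>?Q. fails c")
    case True
    then obtain c where "c \<in> ?Q" "fails c" by (rule bexE)
    then have "\<forall>a\<in>?Q. a \<noteq> c \<longrightarrow> \<not> fails a" using two[of _ c] by metis
    then show ?thesis by (rule exI)
  next
    case False
    \<comment> \<open>With no failing cell, any value serves as the exempted one.\<close>
    then have "\<forall>a\<in>?Q. a \<noteq> undefined \<longrightarrow> \<not> fails a" by metis
    then show ?thesis by (rule exI)
  qed
  then obtain c where c: "\<forall>a\<in>?Q. a \<noteq> c \<longrightarrow> \<not> fails a" by blast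
  obtain u v where uv: "c = (u, v)" by fastforce
  have "good \<omega> (Suc k) l x y"
    unfolding good.simps(2)
  proof (intro conjI exI allI impI)
    fix s t assume "s < N" "t < N"
    then show "\<omega> (l + 1, adr (N * x + s) (N * y + t))" by (rule child)
  next
    fix s t assume "s < N\<^sup>2" "t < N\<^sup>2" "(s, t) \<noteq> (u, v)"
    then have "\<not> fails (s, t)" using c uv by simp
    then show "\<omega> (l + 2, adr (N\<^sup>2 * x + s) (N\<^sup>2 * y + t))"
      "good \<omega> k (l + 2) (N\<^sup>2 * x + s) (N\<^sup>2 * y + t)"
      unfolding fails_def by simp_all
  qed
  then show False using assms(1) by blast
qed

lemma sets_good:
  assumes "0 \<le> p" "p \<le> 1"
  shows "{\<omega>. good \<omega> k l x y} \<in> sets (coins p)" "{\<omega>. \<not> good \<omega> k l x y} \<in> sets (coins p)"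
proof -
  have fin: "finite (descendants N l (2 * k) {adr x y})"
    using N by (intro finite_descendants) auto
  show "{\<omega>. good \<omega> k l x y} \<in> sets (coins p)"
    by (rule sets_determined[OF assms fin determined_by_good])
  show "{\<omega>. \<not> good \<omega> k l x y} \<in> sets (coins p)"
    by (rule sets_determined[OF assms fin determined_by_not[OF determined_by_good]])
qed

text \<open>The hypothesis on \<open>e\<close> says that one step of the recursion preserves the
  bound: \<open>N ^ 2 * (1 - p)\<close> accounts for a lost child, and \<open>N ^ 8\<close> bounds
  the number of ordered pairs among \<open>N ^ 4\<close> cells, of which two distinct ones must
  fail.\<close>

lemma prob_not_good:
  assumes p: "0 \<le> p" "p \<le> 1" and "e \<ge> 0"
    and e: "real N ^ 2 * (1 - p) + real N ^ 8 * ((1 - p) + e)\<^sup>2 \<le> e"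
  shows "measure (coins p) {\<omega>. \<not> good \<omega> k l x y} \<le> e"
proof (induction k arbitrary: l x y)
  case 0
  then show ?case using assms(3) by (simp add: good.simps(1))
next
  case (Suc k)
  have N0: "N > 0" using N by simp
  define cell where "cell a = adr (N\<^sup>2 * x + fst a) (N\<^sup>2 * y + snd a)" for a
  define fails where "fails a \<omega> \<longleftrightarrow> \<not> (\<omega> (l + 2, cell a) \<and>
    good \<omega> k (l + 2) (N\<^sup>2 * x + fst a) (N\<^sup>2 * y + snd a))" for a \<omega>
  \<comment> \<open>The coins deciding a cell are its own and those below it; distinct cells have
    disjoint such sets, so their failures are independent.\<close>
  define F where "F a = {(l + 2, cell a)} \<union> descendants N (l + 2) (2 * k) {cell a}" for a
  define child where "child a = (l + 1, adr (N * x + fst a) (N * y + snd a))" for a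
  let ?Q = "{..<N\<^sup>2} \<times> {..<N\<^sup>2}"
  let ?P = "{(a, b). a \<in> ?Q \<and> b \<in> ?Q \<and> a \<noteq> b}"
  let ?E = "\<lambda>(a, b). {\<omega>. fails a \<omega> \<and> fails b \<omega>}"
  have det: "determined_by (F a) (fails a)" for a
    unfolding F_def fails_def cell_def
    by (intro determined_by_not determined_by_conj determined_by_coin determined_by_good)
  have finF: "finite (F a)" for a
    unfolding F_def using finite_descendants[of "{cell a}" N "l + 2" "2 * k"] N0 by simp
  have disj: "F a \<inter> F b = {}" if "a \<noteq> b" for a b
  proof -
    have "cell a \<noteq> cell b"
      using that unfolding cell_def plane_address_eq_iff[OF ij] by (simp add: prod_eq_iff)
    then show ?thesis unfolding F_def by (rule family_disjoint)
  qed
  have sets_fails: "{\<omega>. fails a \<omega>} \<in> sets (coins p)" for a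
    by (rule sets_determined[OF p finF det])
  have fails_prob: "measure (coins p) {\<omega>. fails a \<omega>} \<le> (1 - p) + e" for a
  proof -
    let ?A = "{\<omega> :: nat \<times> (nat ^ 'n) \<Rightarrow> bool. \<not> \<omega> (l + 2, cell a)}"
    let ?B = "{\<omega>. \<not> good \<omega> k (l + 2) (N\<^sup>2 * x + fst a) (N\<^sup>2 * y + snd a)}"
    have A: "?A \<in> sets (coins p)"
      by (rule sets_determined[OF p _ determined_by_not[OF determined_by_coin]]) simp
    have "{\<omega>. fails a \<omega>} = ?A \<union> ?B"
      unfolding fails_def de_Morgan_conj by (rule Collect_disj_eq)
    then have "measure (coins p) {\<omega>. fails a \<omega>} \<le> measure (coins p) ?A + measure (coins p) ?B"
      using measure_Un_le[OF A sets_good(2)[OF p]] by simp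
    also have "\<dots> \<le> (1 - p) + e" using prob_coin_False[OF p, of "(l + 2, cell a)"] Suc.IH by (intro add_mono) simp_all
    finally show ?thesis .
  qed
  have P_sub: "?P \<subseteq> ?Q \<times> ?Q" by auto
  have finP: "finite ?P" by (rule finite_subset[OF P_sub]) simp
  have cardP: "real (card ?P) \<le> real N ^ 8"
  proof -
    have "card ?P \<le> card (?Q \<times> ?Q)" by (rule card_mono[OF _ P_sub]) simp
    also have "\<dots> = N ^ 8" by (simp add: card_cartesian_product power_mult_distrib flip: power_add power_mult)
    finally have "real (card ?P) \<le> real (N ^ 8)" by (rule of_nat_mono)
    then show ?thesis by (simp only: of_nat_power)
  qed
  have E_sets: "?E z \<in> sets (coins p)" for z
  proof -
    obtain a b where z: "z = (a, b)" by (rule prod.exhaust)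
    have "{\<omega>. fails a \<omega> \<and> fails b \<omega>} = {\<omega>. fails a \<omega>} \<inter> {\<omega>. fails b \<omega>}" by (rule Collect_conj_eq)
    then show ?thesis unfolding z prod.case by (simp only: sets.Int sets_fails)
  qed
  have E_prob: "measure (coins p) (?E z) \<le> ((1 - p) + e)\<^sup>2" if "z \<in> ?P" for z
  proof -
    obtain a b where z: "z = (a, b)" by (rule prod.exhaust)
    then have "a \<noteq> b" using that by simp
    then have "measure (coins p) (?E z) = measure (coins p) {\<omega>. fails a \<omega>} * measure (coins p) {\<omega>. fails b \<omega>}"
      unfolding z prod.case by (intro prob_indep[OF p finF finF _ det det] disj)
    also have "\<dots> \<le> ((1 - p) + e) * ((1 - p) + e)"
      using p assms(3) by (intro mult_mono fails_prob) simp_all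
    finally show ?thesis by (simp add: power2_eq_square)
  qed
  let ?C = "\<Union>a\<in>{..<N} \<times> {..<N}. {\<omega> :: nat \<times> (nat ^ 'n) \<Rightarrow> bool. \<not> \<omega> (child a)}"
  have child_sets: "{\<omega> :: nat \<times> (nat ^ 'n) \<Rightarrow> bool. \<not> \<omega> (child a)} \<in> sets (coins p)" for a
    by (rule sets_determined[OF p _ determined_by_not[OF determined_by_coin]]) simp
  have C_sets: "?C \<in> sets (coins p)" by (intro sets.finite_UN child_sets) auto
  have D_sets: "(\<Union>z\<in>?P. ?E z) \<in> sets (coins p)" using finP E_sets by (intro sets.finite_UN)
  have "measure (coins p) ?C \<le> (\<Sum>a\<in>{..<N} \<times> {..<N}. measure (coins p) {\<omega> :: nat \<times> (nat ^ 'n) \<Rightarrow> bool. \<not> \<omega> (child a)})"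
    by (rule coins.finite_measure_subadditive_finite) (use child_sets in blast)+
  also have "\<dots> = real N ^ 2 * (1 - p)"
    by (simp add: prob_coin_False[OF p] card_cartesian_product power2_eq_square)
  finally have C: "measure (coins p) ?C \<le> real N ^ 2 * (1 - p)" .
  have "measure (coins p) (\<Union>z\<in>?P. ?E z) \<le> (\<Sum>z\<in>?P. measure (coins p) (?E z))"
    by (rule coins.finite_measure_subadditive_finite[OF finP]) (use E_sets in blast)
  also have "\<dots> \<le> (\<Sum>z\<in>?P. ((1 - p) + e)\<^sup>2)" using E_prob by (rule sum_mono)
  also have "\<dots> = real (card ?P) * ((1 - p) + e)\<^sup>2" by simp
  also have "\<dots> \<le> real N ^ 8 * ((1 - p) + e)\<^sup>2" using cardP by (intro mult_right_mono) simp_all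
  finally have D: "measure (coins p) (\<Union>z\<in>?P. ?E z) \<le> real N ^ 8 * ((1 - p) + e)\<^sup>2" .
  have "{\<omega>. \<not> good \<omega> (Suc k) l x y} \<subseteq> ?C \<union> (\<Union>z\<in>?P. ?E z)"
  proof
    fix \<omega> assume "\<omega> \<in> {\<omega>. \<not> good \<omega> (Suc k) l x y}"
    then have "\<not> good \<omega> (Suc k) l x y" by (rule CollectD)
    from not_good_Suc[OF this] show "\<omega> \<in> ?C \<union> (\<Union>z\<in>?P. ?E z)"
    proof (elim disjE exE bexE conjE)
      fix s t assume "s < N" "t < N" "\<not> \<omega> (l + 1, adr (N * x + s) (N * y + t))"
      then have "\<omega> \<in> ?C" by (intro UN_I[of "(s, t)"]) (simp_all add: child_def)
      then show ?thesis by (rule UnI1)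
    next
      fix a b
      assume *: "a \<in> ?Q" "b \<in> ?Q" "a \<noteq> b"
        "case a of (s, t) \<Rightarrow> \<not> (\<omega> (l + 2, adr (N\<^sup>2 * x + s) (N\<^sup>2 * y + t)) \<and>
          good \<omega> k (l + 2) (N\<^sup>2 * x + s) (N\<^sup>2 * y + t))"
        "case b of (s, t) \<Rightarrow> \<not> (\<omega> (l + 2, adr (N\<^sup>2 * x + s) (N\<^sup>2 * y + t)) \<and>
          good \<omega> k (l + 2) (N\<^sup>2 * x + s) (N\<^sup>2 * y + t))"
      have "fails a \<omega>" using *(4) unfolding fails_def cell_def case_prod_beta .
      moreover have "fails b \<omega>" using *(5) unfolding fails_def cell_def case_prod_beta .
      ultimately have "\<omega> \<in> (\<Union>z\<in>?P. ?E z)" using *(1-3) by (intro UN_I[of "(a, b)"]) simp_all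
      then show ?thesis by (rule UnI2)
    qed
  qed
  then have "measure (coins p) {\<omega>. \<not> good \<omega> (Suc k) l x y} \<le> measure (coins p) (?C \<union> (\<Union>z\<in>?P. ?E z))"
    using C_sets D_sets by (intro coins.finite_measure_mono sets.Un)
  also have "\<dots> \<le> measure (coins p) ?C + measure (coins p) (\<Union>z\<in>?P. ?E z)"
    by (rule measure_Un_le[OF C_sets D_sets])
  also have "\<dots> \<le> e" using C D e by linarith
  finally show ?case .
qed

lemma not_AE_totally_disconnected:
  assumes p: "0 \<le> p" "p \<le> 1" and "e \<ge> 0" "e < 1"
    and e: "real N ^ 2 * (1 - p) + real N ^ 8 * ((1 - p) + e)\<^sup>2 \<le> e"
  shows "\<not> (AE \<omega> in coins p. totally_disconnected (limit_set N \<omega> :: (real ^ 'n) set))"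
proof
  assume AE: "AE \<omega> in coins p. totally_disconnected (limit_set N \<omega> :: (real ^ 'n) set)"
  let ?G = "\<lambda>k. {\<omega>. good \<omega> k 0 0 0}"
  have dec: "decseq ?G" using good_Suc_imp_good by (intro decseq_SucI) blast
  have range: "range ?G \<subseteq> sets (coins p)" using sets_good(1)[OF p] by blast
  have "1 - e \<le> measure (coins p) (?G k)" for k
  proof -
    have "UNIV - ?G k = {\<omega>. \<not> good \<omega> k 0 0 0}" by blast
    then have "measure (coins p) {\<omega>. \<not> good \<omega> k 0 0 0} = 1 - measure (coins p) (?G k)"
      using coins.prob_compl[OF sets_good(1)[OF p, of k 0 0 0]] by simp
    then show ?thesis using prob_not_good[OF p assms(3) e, of k 0 0 0] by linarith
  qed
  moreover have "(\<lambda>k. measure (coins p) (?G k)) \<longlonglongrightarrow> measure (coins p) (\<Inter>k. ?G k)"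
    by (rule coins.finite_Lim_measure_decseq[OF range dec])
  ultimately have pos: "1 - e \<le> measure (coins p) (\<Inter>k. ?G k)" by (intro LIMSEQ_le_const) auto
  have sets: "(\<Inter>k. ?G k) \<in> sets (coins p)" using range by (intro sets.countable_INT) blast+
  have "AE \<omega> in coins p. \<omega> \<notin> (\<Inter>k. ?G k)"
    using AE
  proof (rule eventually_mono)
    fix \<omega> :: "nat \<times> (nat ^ 'n) \<Rightarrow> bool"
    assume "totally_disconnected (limit_set N \<omega> :: (real ^ 'n) set)"
    then show "\<omega> \<notin> (\<Inter>k. ?G k)" using good_imp_not_totally_disconnected[of \<omega>] by blast
  qed
  then have "measure (coins p) (\<Inter>k. ?G k) = 0" using coins.prob_eq_0[OF sets] by simp
  then show False using pos assms(4) by simp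
qed

end

lemma exists_not_AE_totally_disconnected:
  assumes "CARD('n::finite) \<ge> 2" "N \<ge> 2"
  shows "\<exists>p. 0 < p \<and> p < 1 \<and>
    \<not> (AE \<omega> in coins p. totally_disconnected (limit_set N \<omega> :: (real ^ 'n) set))"
proof -
  have "\<not> is_singleton (UNIV :: 'n set)" using assms(1) by (auto simp: is_singleton_altdef)
  then obtain i j :: 'n where ij: "i \<noteq> j" by (metis UNIV_I is_singletonI' UNIV_not_empty)
  \<comment> \<open>With \<open>d = 1 - p\<close> the constants give
    \<open>N ^ 2 * d = e / 2\<close>, and, as \<open>d\<close> is at most \<open>e\<close>, the
    quadratic term is at most \<open>N ^ 8 * (2 * e) ^ 2 = e / 2\<close>.\<close>
  define e where "e = 1 / (8 * real N ^ 8)"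
  define d where "d = e / (2 * real N ^ 2)"
  have N8: "1 \<le> real N ^ 8" "1 \<le> real N ^ 2" using assms(2) by (simp_all add: one_le_power)
  have e: "0 < e" "real N ^ 8 * e = 1 / 8" using assms(2) by (simp_all add: e_def)
  have "1 < 8 * real N ^ 8" using N8 by linarith
  then have e1: "e < 1" unfolding e_def by (subst divide_less_eq_1_pos) linarith+
  have Nd: "real N ^ 2 * d = e / 2" using assms(2) by (simp add: d_def)
  have d: "0 < d" using e(1) assms(2) by (simp add: d_def)
  have "1 * d \<le> real N ^ 2 * d" using N8 d by (intro mult_right_mono) auto
  then have de: "d \<le> e" "d < 1" using Nd e(1) e1 by simp_all
  have "(d + e)\<^sup>2 \<le> (2 * e)\<^sup>2" using d de(1) by (intro power_mono) auto
  then have "real N ^ 8 * (d + e)\<^sup>2 \<le> real N ^ 8 * (2 * e)\<^sup>2" using N8 by (intro mult_left_mono) auto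
  also have "\<dots> = 4 * e * (real N ^ 8 * e)" by (simp add: power2_eq_square)
  also have "\<dots> = e / 2" using e(2) by simp
  finally have "real N ^ 2 * (1 - (1 - d)) + real N ^ 8 * ((1 - (1 - d)) + e)\<^sup>2 \<le> e" using Nd by simp
  then have "\<not> (AE \<omega> in coins (1 - d). totally_disconnected (limit_set N \<omega> :: (real ^ 'n) set))"
    using not_AE_totally_disconnected[OF assms(2) ij, of "1 - d" e] d de e(1) e1 by simp
  then show ?thesis using d de by (intro exI[of _ "1 - d"]) simp
qed

section \<open>The critical point\<close>

theorem theorem4p1:
  fixes N :: nat
  assumes "CARD('n::finite) \<ge> 2" and "N \<ge> 2"
  shows "0 < pc_hat TYPE('n) N \<and> pc_hat TYPE('n) N < 1
    \<and> crossing_prob TYPE('n) N (pc_hat TYPE('n) N) > 0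
    \<and> (\<forall>p. 0 < p \<and> p < pc_hat TYPE('n) N \<longrightarrow>
          (AE \<omega> in coins p. totally_disconnected (limit_set N \<omega> :: (real ^ 'n) set)))
    \<and> pc_hat TYPE('n) N = pc_tilde TYPE('n) N"
proof -
  have N: "N > 0" using assms(2) by simp
  let ?td = "\<lambda>p. AE \<omega> in coins p. totally_disconnected (limit_set N \<omega> :: (real ^ 'n) set)"
  let ?phi = "crossing_prob TYPE('n) N"
  let ?u = "span_prob TYPE('n) N"
  let ?Q = "{q :: nat ^ 'n. \<forall>i. q $ i < N ^ 6}"
  define D where "D = (real (card ?Q))\<^sup>2"
  have "(0 :: nat ^ 'n) \<in> ?Q" using N by simp
  then have "?Q \<noteq> {}" by blast
  then have "card ?Q > 0" by (intro card_gt_0_iff[THEN iffD2] conjI finite_vec_less)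
  then have D: "D > 0" by (simp add: D_def)
  \<comment> \<open>The gap: unless the limit set is almost surely totally disconnected, no depth
    may fall below the threshold \<open>1 / D\<close>.\<close>
  have big: "1 / D \<le> ?u p k" if "0 \<le> p" "p \<le> 1" "\<not> ?td p" for p k
  proof -
    have "1 \<le> D * ?u p k"
    proof (rule ccontr)
      assume "\<not> 1 \<le> D * ?u p k"
      then have "(real (card ?Q))\<^sup>2 * ?u p k < 1" unfolding D_def by simp
      from AE_totally_disconnected[OF assms(2) that(1,2) this] that(3) show False by blast
    qed
    then show ?thesis using D by (simp add: pos_divide_le_eq mult.commute)
  qed
  have pos: "?phi p > 0" if "0 < p" "p \<le> 1" "\<And>k. 1 / D \<le> ?u p k" for p
    by (rule crossing_prob_pos[OF assms(2) that(1,2) _ that(3)]) (use D in simp)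
  have not_td: "\<not> ?td p" if "0 \<le> p" "p \<le> 1" "?phi p > 0" for p
    by (rule crossing_prob_pos_imp_not_AE[OF assms(2) that])
  define G where "G = {p. 0 < p \<and> p < 1 \<and> ?phi p > 0}"
  have G_iff: "p \<in> G \<longleftrightarrow> \<not> ?td p" if "0 < p" "p < 1" for p
  proof
    show "\<not> ?td p" if "p \<in> G"
      by (rule not_td) (use that in \<open>simp_all add: G_def\<close>)
    show "p \<in> G" if "\<not> ?td p"
    proof -
      have "1 / D \<le> ?u p k" for k by (rule big[OF _ _ that]) (use \<open>0 < p\<close> \<open>p < 1\<close> in simp_all)
      then have "?phi p > 0" using \<open>0 < p\<close> \<open>p < 1\<close> by (intro pos) simp_all
      then show ?thesis using \<open>0 < p\<close> \<open>p < 1\<close> unfolding G_def by simp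
    qed
  qed
  have G_big: "1 / D \<le> ?u p k" if "p \<in> G" for p k
  proof -
    have p: "0 < p" "p < 1" "?phi p > 0" using that unfolding G_def by simp_all
    have "\<not> ?td p" by (rule not_td) (use p in simp_all)
    then show ?thesis using p by (intro big) simp_all
  qed
  let ?c = "Inf G"
  have hat: "pc_hat TYPE('n) N = ?c" by (simp add: pc_hat_def G_def)
  obtain p1 where p1: "0 < p1" "p1 < 1" "\<not> ?td p1"
    using exists_not_AE_totally_disconnected[OF assms] by blast
  have p1G: "p1 \<in> G" by (rule iffD2[OF G_iff[OF p1(1,2)] p1(3)])
  have bdd: "bdd_below G" unfolding G_def by (rule bdd_belowI[of _ 0]) simp
  have c_less: "?c < 1" using cInf_lower[OF p1G bdd] p1(2) by linarith
  have c_ge: "0 \<le> ?c" using p1G by (intro cInf_greatest) (auto simp: G_def)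
  have cont: "continuous_on X (\<lambda>p. bernoulli_sum p (descendants N 3 k {y :: nat ^ 'n. \<forall>i. y $ i < N ^ 3}) (\<lambda>\<omega>. spans N \<omega> k))"
    for X k by (rule continuous_on_bernoulli_sum)
  have c_big: "1 / D \<le> ?u ?c k" for k
  proof -
    \<comment> \<open>On the unit interval the span probability agrees with this polynomial, which
      is continuous on all reals; its superlevel set is closed and contains \<open>G\<close>, hence
      also \<open>Inf G\<close>.\<close>
    let ?f = "\<lambda>p. bernoulli_sum p (descendants N 3 k {y :: nat ^ 'n. \<forall>i. y $ i < N ^ 3}) (\<lambda>\<omega>. spans N \<omega> k)"
    have cl: "closed {p. 1 / D \<le> ?f p}"
      by (intro closed_Collect_le continuous_on_const cont)
    have "G \<subseteq> {p. 1 / D \<le> ?f p}"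
    proof
      fix p assume "p \<in> G"
      moreover have "?u p k = ?f p" using \<open>p \<in> G\<close> by (intro span_prob_eq N) (simp_all add: G_def)
      ultimately show "p \<in> {p. 1 / D \<le> ?f p}" using G_big[of p k] by simp
    qed
    then have "?c \<in> {p. 1 / D \<le> ?f p}"
      by (rule closed_subset_contains_Inf[OF cl _ _ bdd]) (use p1G in blast)
    moreover have "?u ?c k = ?f ?c" using c_ge c_less by (intro span_prob_eq N) simp_all
    ultimately show ?thesis by simp
  qed
  have c_pos: "0 < ?c"
  proof (rule ccontr)
    assume "\<not> 0 < ?c"
    then have c0: "?c = 0" using c_ge by simp
    have fin: "finite (descendants N 3 1 {y :: nat ^ 'n. \<forall>i. y $ i < N ^ 3})"
      by (intro finite_descendants N finite_vec_less)
    have "?u 0 1 = of_bool (spans N (\<lambda>_ :: nat \<times> (nat ^ 'n). False) 1)"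
      unfolding span_prob_eq[OF N order_refl zero_le_one] by (rule bernoulli_sum_0[OF fin])
    then have "?u 0 1 = 0" using not_spans_False by simp
    then show False using c_big[of 1] D unfolding c0 by simp
  qed
  have phi_c: "?phi ?c > 0" by (rule pos[OF c_pos _ c_big]) (use c_less in simp)
  have below: "?td p" if "0 < p" "p < ?c" for p
  proof -
    have "p \<notin> G" using cInf_lower[OF _ bdd, of p] that(2) by linarith
    then show ?thesis using G_iff[OF that(1)] that(2) c_less by (meson less_trans)
  qed
  define T where "T = {p. 0 < p \<and> p < 1 \<and> ?td p}"
  have T_below: "p \<in> T" if "0 < p" "p < ?c" for p
    using below[OF that] that c_less unfolding T_def by simp
  \<comment> \<open>Monotonicity enters through the span probabilities: the lower bound at some
    supercritical \<open>g < p\<close> is inherited by \<open>p\<close> and forces a positive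
    crossing probability there.\<close>
  have T_le: "p \<le> ?c" if "p \<in> T" for p
  proof (rule ccontr)
    assume "\<not> p \<le> ?c"
    then have "?c < p" by simp
    moreover have "G \<noteq> {}" using p1G by blast
    ultimately obtain g where g: "g \<in> G" "g < p" using cInf_lessD by blast
    have p: "0 < p" "p < 1" "?td p" using that unfolding T_def by simp_all
    have "0 < g" using g(1) unfolding G_def by simp
    then have "1 / D \<le> ?u p k" for k
      using G_big[OF g(1), of k] span_prob_mono[OF N, where 'n = 'n, of g p k] g(2) p by simp
    then have "?phi p > 0" using p by (intro pos) simp_all
    from not_td[OF _ _ this] p show False by simp
  qed
  have half: "?c / 2 \<in> T" using c_pos by (intro T_below) simp_all
  have "Sup T \<le> ?c" using cSup_least[of T ?c] half T_le by auto
  moreover have "?c \<le> Sup T"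
  proof (rule dense_le_bounded[OF c_pos])
    fix w assume "0 < w" "w < ?c"
    then have "w \<in> T" by (rule T_below)
    moreover have "bdd_above T" using T_le by (rule bdd_aboveI)
    ultimately show "w \<le> Sup T" by (rule cSup_upper)
  qed
  ultimately have "Sup T = ?c" by simp
  then have tilde: "pc_tilde TYPE('n) N = ?c" by (simp add: pc_tilde_def T_def)
  show ?thesis unfolding hat tilde
    by (intro conjI allI impI c_pos c_less phi_c refl) (erule conjE, rule below)
qed

end
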